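(* Let $a>0$, let $n\ge 0$ be an integer, and let $\alpha$ be real with $0<|\alpha|<1$. Suppose that $f_1\in C^{2n+1}[0,a]$ and $g\in C^{2n+2}[0,a]$ (with $g$ real-valued), $g(0)=0$ and $g'(x)>0$ for all $x\in[0,a]$, and that $f_1$ and $g$ are independent of the real parameter $w>0$. Then there is a constant $C$ independent of $w$ such that for every $w>0$ there exist a function $q_1$ on $[0,a]$ and a number $c_0\in\mathbb{C}$ satisfying $$ iwg'(x)c_0+g(x)q_1'(x)+[1+\alpha+iwg(x)]\,g'(x)q_1(x)=f_1(x),\qquad x\in[0,a], $$ and $$ |c_0|<C/w \quad\text{and}\quad \|\mathcal{D}^{j}q_1\|_\infty<C/w,\qquad j=0,1,\ldots,n. $$
   Context: $\mathcal{D}^j$ denotes the $j$-th derivative with respect to $x$, $\|\cdot\|_\infty$ is the supremum norm on $[0,a]$, and $i$ is the imaginary unit. The functions $f_1$ and $q_1$ may be complex-valued. The pair $(q_1,c_0)$ is allowed to depend on $w$. *)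

theory Defs
  imports "HOL-Analysis.Analysis"
begin

(* The derivative is taken within S, so on a compact interval it is one-sided at
   the end points and values outside S are irrelevant.  It is meaningful only
   together with a differentiability assumption such as C_on below. *)
definition iter_deriv_on :: "real set \<Rightarrow> nat \<Rightarrow> (real \<Rightarrow> 'a::real_normed_vector) \<Rightarrow> real \<Rightarrow> 'a"
  where "iter_deriv_on S j f = ((\<lambda>h x. vector_derivative h (at x within S)) ^^ j) f"

definition C_on :: "nat \<Rightarrow> real set \<Rightarrow> (real \<Rightarrow> 'a::real_normed_vector) \<Rightarrow> bool"
  where "C_on k S f \<longleftrightarrow>
    (\<forall>j<k. iter_deriv_on S j f differentiable_on S) \<and> continuous_on S (iter_deriv_on S k f)"

(* A real supremum: it carries its usual meaning for functions bounded on S,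
   in particular for continuous functions on a compact S. *)
definition sup_norm_on :: "real set \<Rightarrow> (real \<Rightarrow> 'a::real_normed_vector) \<Rightarrow> real"
  where "sup_norm_on S h = (SUP x\<in>S. norm (h x))"

end

theory Submission
  imports Defs
begin

text \<open>
  Divide the equation by \<open>g'\<close> and put \<open>F = f\<^sub>1 / g'\<close>, \<open>c = \<i> w c\<^sub>0\<close>; it becomes
  \<open>(g / g') q' + (1 + \<alpha> + \<i> w g) q = F - c\<close>, a first order equation whose coefficient \<open>g\<close>
  vanishes at \<open>0\<close>. Because \<open>\<alpha> > -1\<close>, it has for every \<open>c\<close> exactly one solution that stays bounded
  at \<open>0\<close>, namely
  \<open>g(x) powr (-1-\<alpha>) e^(-\<i> w g(x)) \<integral>\<^sub>0\<^sup>x g(s) powr \<alpha> g'(s) e^(\<i> w g(s)) (F(s) - c) ds\<close>.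
  In general it oscillates with frequency \<open>w\<close>, and each derivative costs a factor \<open>w\<close>. The free
  constant \<open>c\<close> is used to remove this oscillation to high order.

  Integration by parts is what makes this work. Put \<open>A = (F - F(0)) / (\<i> g)\<close>, which extends
  continuously to \<open>0\<close>. For \<open>q = A / w\<close> the left-hand side is \<open>F - F(0) - R F / w\<close> with a
  residual \<open>R F\<close> that does not depend on \<open>w\<close>. Hence the solution with right-hand side \<open>F - F(0)\<close> equals
  \<open>(A + S) / w\<close>, where \<open>S\<close> is the solution with right-hand side \<open>R F\<close>
  (lemma \<open>solution_by_parts\<close>). One step
  costs one derivative of \<open>F\<close> and gains one factor \<open>1 / w\<close>. After \<open>n + 1\<close> steps, with \<open>c\<close> the
  accumulated sum of the values at \<open>0\<close> divided by powers of \<open>w\<close>, the remaining oscillatory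
  solution has the prefactor \<open>w^(-n-1)\<close>, so its derivatives up to order \<open>n\<close> are \<open>O(1/w)\<close>; the
  non-oscillatory terms carry a factor \<open>1 / w\<close> already (lemma \<open>nonoscillatory_expansion\<close>). The
  remainder must still be \<open>n\<close> times differentiable after \<open>n + 1\<close> steps, which explains the
  \<open>2n + 1\<close> derivatives of \<open>f\<^sub>1\<close>. For \<open>w < 1\<close> nothing has to be removed, and \<open>c = 0\<close> works.

  No change of variables \<open>t = g(x)\<close> is made. Writing \<open>g(x) = x h(x)\<close> with \<open>h > 0\<close> and
  \<open>s = u x\<close>, the integral above becomes the product of
  \<open>h(x) powr (-1-\<alpha>) e^(-\<i> w g(x))\<close> and an average \<open>\<integral>\<^sub>0\<^sup>1 u powr \<alpha> \<psi>(u x) du\<close> over dilations. Such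
  averages commute with differentiation up to a change of the weight, so bounds on the derivatives of
  \<open>\<psi>\<close> pass to the average. The same averages represent the quotients \<open>(F(x) - F(0)) / x\<close>.
\<close>

section \<open>Iterated one-sided derivatives\<close>

text \<open>
  A name for the single derivative keeps the simplifier from unfolding \<open>iter_deriv_on S 1\<close>
  and \<open>iter_deriv_on S (Suc 0)\<close> into each other.
\<close>

definition deriv_on :: "real set \<Rightarrow> (real \<Rightarrow> 'a::real_normed_vector) \<Rightarrow> real \<Rightarrow> 'a"
  where "deriv_on S f x = vector_derivative f (at x within S)"

lemma iter_deriv_on_0 [simp]: "iter_deriv_on S 0 f = f"
  by (simp add: iter_deriv_on_def)

lemma iter_deriv_on_Suc:
  "iter_deriv_on S (Suc j) f = iter_deriv_on S j (deriv_on S f)"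
  by (simp add: iter_deriv_on_def funpow_Suc_right deriv_on_def[abs_def] del: funpow.simps)

lemma iter_deriv_on_1: "iter_deriv_on S 1 f = deriv_on S f"
  by (simp add: iter_deriv_on_Suc)

lemma deriv_on_cong:
  assumes "\<And>x. x \<in> S \<Longrightarrow> f x = g x" and "x \<in> S"
  shows "deriv_on S f x = deriv_on S g x"
proof -
  have "(f has_vector_derivative d) (at x within S) \<longleftrightarrow> (g has_vector_derivative d) (at x within S)"
    for d
    using has_vector_derivative_transform[of x S f g d]
      has_vector_derivative_transform[of x S g f d] assms by auto
  then show ?thesis
    by (simp add: deriv_on_def vector_derivative_def)
qed

lemma iter_deriv_on_cong:
  assumes "\<And>x. x \<in> S \<Longrightarrow> f x = g x" and "x \<in> S"
  shows "iter_deriv_on S j f x = iter_deriv_on S j g x"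
  using assms
proof (induction j arbitrary: f g x)
  case (Suc j)
  show ?case
    unfolding iter_deriv_on_Suc[of S j] by (intro Suc.IH deriv_on_cong Suc.prems)
qed simp

lemma C_on_0 [simp]: "C_on 0 S f \<longleftrightarrow> continuous_on S f"
  by (simp add: C_on_def)

lemma C_on_Suc:
  "C_on (Suc k) S f \<longleftrightarrow> f differentiable_on S \<and> C_on k S (deriv_on S f)"
  by (auto simp: C_on_def All_less_Suc2 iter_deriv_on_Suc)

lemma C_on_Suc_imp_C_on: "C_on (Suc k) S f \<Longrightarrow> C_on k S f"
  by (induction k arbitrary: f)
     (auto simp: C_on_Suc intro: differentiable_imp_continuous_on)

lemma C_on_le:
  assumes "C_on k S f" and "j \<le> k"
  shows "C_on j S f"
  using assms(2,1) by (induction rule: inc_induct) (auto dest: C_on_Suc_imp_C_on)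

lemma C_on_imp_continuous_on: "C_on k S f \<Longrightarrow> continuous_on S f"
  using C_on_le[of k S f 0] by simp

lemma differentiable_on_cong:
  assumes "\<And>x. x \<in> S \<Longrightarrow> f x = g x"
  shows "f differentiable_on S \<longleftrightarrow> g differentiable_on S"
proof -
  have "(f has_derivative f') (at x within S) \<longleftrightarrow> (g has_derivative f') (at x within S)"
    if "x \<in> S" for x f'
    using has_derivative_transform[of x S f g] has_derivative_transform[of x S g f] assms that
    by auto
  then show ?thesis
    by (auto simp: differentiable_on_def differentiable_def)
qed

lemma C_on_cong:
  assumes "\<And>x. x \<in> S \<Longrightarrow> f x = g x"
  shows "C_on k S f \<longleftrightarrow> C_on k S g"
  using assms
proof (induction k arbitrary: f g)
  case 0
  then show ?case by (auto cong: continuous_on_cong)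
next
  case (Suc k)
  have "C_on k S (deriv_on S f) \<longleftrightarrow> C_on k S (deriv_on S g)"
    by (intro Suc.IH deriv_on_cong Suc.prems)
  then show ?case
    using differentiable_on_cong[of S f g] Suc.prems by (simp add: C_on_Suc)
qed

locale positive_interval =
  fixes a :: real
  assumes a_pos: "0 < a"
begin

abbreviation D :: "(real \<Rightarrow> 'a::real_normed_vector) \<Rightarrow> real \<Rightarrow> 'a"
  where "D f \<equiv> deriv_on {0..a} f"

lemma D_eqI:
  assumes "(f has_vector_derivative d) (at x within {0..a})" and "x \<in> {0..a}"
  shows "D f x = d"
  using assms a_pos vector_derivative_within_cbox[of 0 a x f d]
  by (simp add: deriv_on_def)

lemma has_vector_derivative_D:
  assumes "f differentiable_on {0..a}" and "x \<in> {0..a}"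
  shows "(f has_vector_derivative D f x) (at x within {0..a})"
  using assms
  by (simp add: deriv_on_def differentiable_on_def vector_derivative_works[symmetric])

lemma C_on_Suc_deriv:
  assumes "C_on (Suc k) {0..a} f" and "x \<in> {0..a}"
  shows "(f has_vector_derivative D f x) (at x within {0..a})"
  using assms by (auto simp: C_on_Suc intro: has_vector_derivative_D)

lemma C_on_SucI:
  assumes d: "\<And>x. x \<in> {0..a} \<Longrightarrow> (f has_vector_derivative f' x) (at x within {0..a})"
    and "C_on k {0..a} f'"
  shows "C_on (Suc k) {0..a} f"
proof -
  have "D f x = f' x" if "x \<in> {0..a}" for x
    using d that by (intro D_eqI) auto
  then have "C_on k {0..a} (D f)"
    using assms(2) C_on_cong[of "{0..a}" "D f" f' k] by simp
  moreover have "f differentiable_on {0..a}"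
    using d unfolding differentiable_on_def by (blast intro: differentiableI_vector)
  ultimately show ?thesis by (simp add: C_on_Suc)
qed

lemma C_on_of_real:
  "C_on k {0..a} f \<Longrightarrow> C_on k {0..a} (\<lambda>x. complex_of_real (f x))"
proof (induction k arbitrary: f)
  case 0
  then show ?case by (auto intro!: continuous_intros)
next
  case (Suc k)
  show ?case
  proof (rule C_on_SucI)
    show "((\<lambda>x. complex_of_real (f x)) has_vector_derivative of_real (D f x)) (at x within {0..a})"
      if "x \<in> {0..a}" for x
      using C_on_Suc_deriv[OF Suc.prems that]
      by (intro bounded_linear.has_vector_derivative[OF bounded_linear_of_real])
    show "C_on k {0..a} (\<lambda>x. complex_of_real (D f x))"
      using Suc by (auto simp: C_on_Suc)
  qed
qed

section \<open>Families with derivatives of controlled growth\<close>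

text \<open>
  A family \<open>\<phi> w\<close> of size \<open>\<rho> w\<close> each of whose derivatives costs a factor \<open>\<sigma> w\<close>, uniformly in
  \<open>w \<in> I\<close>. Oscillating families have \<open>\<sigma> w = 1 + w\<close>, families that vary slowly have \<open>\<sigma> w = 1\<close>. The
  sign conditions make the bounds monotone, so that two constants \<open>K\<close> can be merged.
\<close>

definition scaled_C ::
  "'w set \<Rightarrow> ('w \<Rightarrow> real) \<Rightarrow> nat \<Rightarrow> ('w \<Rightarrow> real) \<Rightarrow> ('w \<Rightarrow> real \<Rightarrow> complex) \<Rightarrow> bool"
  where "scaled_C I \<sigma> k \<rho> \<phi> \<longleftrightarrow>
    (\<forall>w\<in>I. 0 \<le> \<rho> w \<and> 1 \<le> \<sigma> w \<and> C_on k {0..a} (\<phi> w)) \<and>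
    (\<exists>K\<ge>0. \<forall>w\<in>I. \<forall>j\<le>k. \<forall>x\<in>{0..a}.
       norm (iter_deriv_on {0..a} j (\<phi> w) x) \<le> K * (\<rho> w * \<sigma> w ^ j))"

lemma scaled_C_I:
  assumes "0 \<le> K"
    and "\<And>w. w \<in> I \<Longrightarrow> 0 \<le> \<rho> w" and "\<And>w. w \<in> I \<Longrightarrow> 1 \<le> \<sigma> w"
    and "\<And>w. w \<in> I \<Longrightarrow> C_on k {0..a} (\<phi> w)"
    and "\<And>w j x. w \<in> I \<Longrightarrow> j \<le> k \<Longrightarrow> x \<in> {0..a} \<Longrightarrow>
       norm (iter_deriv_on {0..a} j (\<phi> w) x) \<le> K * (\<rho> w * \<sigma> w ^ j)"
  shows "scaled_C I \<sigma> k \<rho> \<phi>"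
  unfolding scaled_C_def using assms by blast

lemma scaled_C_E:
  assumes "scaled_C I \<sigma> k \<rho> \<phi>"
  obtains K where "0 \<le> K"
    and "\<And>w j x. w \<in> I \<Longrightarrow> j \<le> k \<Longrightarrow> x \<in> {0..a} \<Longrightarrow>
       norm (iter_deriv_on {0..a} j (\<phi> w) x) \<le> K * (\<rho> w * \<sigma> w ^ j)"
  using assms unfolding scaled_C_def by blast

lemma scaled_C_D:
  assumes "scaled_C I \<sigma> k \<rho> \<phi>" and "w \<in> I"
  shows "0 \<le> \<rho> w" and "1 \<le> \<sigma> w" and "C_on k {0..a} (\<phi> w)"
  using assms unfolding scaled_C_def by blast+

lemma scaled_C_0:
  "scaled_C I \<sigma> 0 \<rho> \<phi> \<longleftrightarrow>
    (\<forall>w\<in>I. 0 \<le> \<rho> w \<and> 1 \<le> \<sigma> w \<and> continuous_on {0..a} (\<phi> w)) \<and>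
    (\<exists>K\<ge>0. \<forall>w\<in>I. \<forall>x\<in>{0..a}. norm (\<phi> w x) \<le> K * \<rho> w)"
  by (simp add: scaled_C_def)

lemma scaled_C_0_I:
  assumes "0 \<le> K"
    and "\<And>w. w \<in> I \<Longrightarrow> 0 \<le> \<rho> w \<and> 1 \<le> \<sigma> w \<and> continuous_on {0..a} (\<phi> w)"
    and "\<And>w x. w \<in> I \<Longrightarrow> x \<in> {0..a} \<Longrightarrow> norm (\<phi> w x) \<le> K * \<rho> w"
  shows "scaled_C I \<sigma> 0 \<rho> \<phi>"
  unfolding scaled_C_0 using assms by blast

text \<open>
  All closure properties below are inductions on the order that use this recursion; differentiating
  a member moves one factor \<open>\<sigma>\<close> into the size.
\<close>

lemma scaled_C_Suc:
  "scaled_C I \<sigma> (Suc k) \<rho> \<phi> \<longleftrightarrow>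
    (\<forall>w\<in>I. \<phi> w differentiable_on {0..a}) \<and> scaled_C I \<sigma> 0 \<rho> \<phi> \<and>
    scaled_C I \<sigma> k (\<lambda>w. \<rho> w * \<sigma> w) (\<lambda>w. D (\<phi> w))"
    (is "?L \<longleftrightarrow> ?R")
proof
  assume L: ?L
  obtain K where K: "0 \<le> K" "\<And>w j x. w \<in> I \<Longrightarrow> j \<le> Suc k \<Longrightarrow> x \<in> {0..a} \<Longrightarrow>
       norm (iter_deriv_on {0..a} j (\<phi> w) x) \<le> K * (\<rho> w * \<sigma> w ^ j)"
    by (rule scaled_C_E[OF L]) blast
  note pos = scaled_C_D[OF L]
  have "scaled_C I \<sigma> 0 \<rho> \<phi>"
  proof (rule scaled_C_I[OF K(1)])
    show "C_on 0 {0..a} (\<phi> w)" if "w \<in> I" for w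
      using pos(3)[OF that] C_on_imp_continuous_on by simp
    show "norm (iter_deriv_on {0..a} j (\<phi> w) x) \<le> K * (\<rho> w * \<sigma> w ^ j)"
      if "w \<in> I" "j \<le> 0" "x \<in> {0..a}" for w j x
      using K(2)[of w j x] that by simp
  qed (use pos in auto)
  moreover have "scaled_C I \<sigma> k (\<lambda>w. \<rho> w * \<sigma> w) (\<lambda>w. D (\<phi> w))"
  proof (rule scaled_C_I[OF K(1)])
    show "norm (iter_deriv_on {0..a} j (D (\<phi> w)) x) \<le> K * (\<rho> w * \<sigma> w * \<sigma> w ^ j)"
      if "w \<in> I" "j \<le> k" "x \<in> {0..a}" for w j x
      using K(2)[of w "Suc j" x] that by (simp add: iter_deriv_on_Suc mult.assoc)
    show "0 \<le> \<rho> w * \<sigma> w" if "w \<in> I" for w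
      using pos(1,2)[OF that] by simp
  qed (use pos in \<open>auto simp: C_on_Suc\<close>)
  ultimately show ?R
    using pos(3) by (simp add: C_on_Suc)
next
  assume R: ?R
  then obtain K where K: "0 \<le> K" "\<And>w x. w \<in> I \<Longrightarrow> x \<in> {0..a} \<Longrightarrow> norm (\<phi> w x) \<le> K * \<rho> w"
    unfolding scaled_C_0 by blast
  have R': "scaled_C I \<sigma> k (\<lambda>w. \<rho> w * \<sigma> w) (\<lambda>w. D (\<phi> w))" "scaled_C I \<sigma> 0 \<rho> \<phi>"
    using R by auto
  obtain L where L: "0 \<le> L" "\<And>w j x. w \<in> I \<Longrightarrow> j \<le> k \<Longrightarrow> x \<in> {0..a} \<Longrightarrow>
       norm (iter_deriv_on {0..a} j (D (\<phi> w)) x) \<le> L * (\<rho> w * \<sigma> w * \<sigma> w ^ j)"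
    by (rule scaled_C_E[OF R'(1)]) blast
  have pos: "0 \<le> \<rho> w" "1 \<le> \<sigma> w" "C_on (Suc k) {0..a} (\<phi> w)" if "w \<in> I" for w
    using R scaled_C_D[OF R'(2) that] scaled_C_D[OF R'(1) that] that by (auto simp: C_on_Suc)
  have "norm (iter_deriv_on {0..a} j (\<phi> w) x) \<le> (K + L) * (\<rho> w * \<sigma> w ^ j)"
    if w: "w \<in> I" and "j \<le> Suc k" "x \<in> {0..a}" for w j x
  proof (cases j)
    case 0
    have "K * \<rho> w \<le> (K + L) * \<rho> w"
      using pos[OF w] L(1) by (intro mult_right_mono) auto
    then show ?thesis using K(2)[of w x] that 0 by simp
  next
    case (Suc i)
    have "L * (\<rho> w * \<sigma> w ^ j) \<le> (K + L) * (\<rho> w * \<sigma> w ^ j)"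
      using pos[OF w] K(1) by (intro mult_right_mono) auto
    then show ?thesis using L(2)[of w i x] that Suc by (simp add: iter_deriv_on_Suc mult.assoc)
  qed
  then show ?L
    using pos K(1) L(1) by (intro scaled_C_I[of "K + L"]) auto
qed

lemma scaled_C_cong:
  assumes "\<And>w x. w \<in> I \<Longrightarrow> x \<in> {0..a} \<Longrightarrow> \<phi> w x = \<psi> w x"
    and "scaled_C I \<sigma> k \<rho> \<phi>"
  shows "scaled_C I \<sigma> k \<rho> \<psi>"
proof -
  have "iter_deriv_on {0..a} j (\<phi> w) x = iter_deriv_on {0..a} j (\<psi> w) x"
    if "w \<in> I" "x \<in> {0..a}" for w j x
    using that assms(1) by (intro iter_deriv_on_cong) auto
  moreover have "C_on k {0..a} (\<psi> w)" if "w \<in> I" for w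
    using that assms(1) scaled_C_D(3)[OF assms(2) that] C_on_cong[of "{0..a}" "\<phi> w" "\<psi> w" k]
    by simp
  moreover obtain K where "0 \<le> K" "\<And>w j x. w \<in> I \<Longrightarrow> j \<le> k \<Longrightarrow> x \<in> {0..a} \<Longrightarrow>
       norm (iter_deriv_on {0..a} j (\<phi> w) x) \<le> K * (\<rho> w * \<sigma> w ^ j)"
    by (rule scaled_C_E[OF assms(2)]) blast
  ultimately show ?thesis
    using scaled_C_D(1,2)[OF assms(2)] by (intro scaled_C_I[of K]) auto
qed

lemma scaled_C_SucI:
  assumes d: "\<And>w x. w \<in> I \<Longrightarrow> x \<in> {0..a} \<Longrightarrow>
      (\<phi> w has_vector_derivative \<psi> w x) (at x within {0..a})"
    and "scaled_C I \<sigma> 0 \<rho> \<phi>" and "scaled_C I \<sigma> k (\<lambda>w. \<rho> w * \<sigma> w) \<psi>"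
  shows "scaled_C I \<sigma> (Suc k) \<rho> \<phi>"
proof -
  have "scaled_C I \<sigma> k (\<lambda>w. \<rho> w * \<sigma> w) (\<lambda>w. D (\<phi> w))"
    using assms(3) by (rule scaled_C_cong[rotated]) (auto intro!: D_eqI[symmetric] d)
  moreover have "\<phi> w differentiable_on {0..a}" if "w \<in> I" for w
    using d that unfolding differentiable_on_def by (blast intro: differentiableI_vector)
  ultimately show ?thesis
    using assms(2) by (simp add: scaled_C_Suc)
qed

lemma scaled_C_deriv:
  assumes "scaled_C I \<sigma> (Suc k) \<rho> \<phi>" "w \<in> I" "x \<in> {0..a}"
  shows "(\<phi> w has_vector_derivative D (\<phi> w) x) (at x within {0..a})"
  using assms by (auto simp: scaled_C_Suc intro: has_vector_derivative_D)

text \<open>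
  The comparison is needed only for the finitely many orders \<open>i \<le> j\<close>. This is how a loss
  \<open>(1 + w) ^ i\<close> is traded for the uniform size \<open>w ^ n\<close>.
\<close>

lemma scaled_C_weaken:
  assumes F: "scaled_C I \<sigma> k \<rho> \<phi>" and "J \<subseteq> I" "j \<le> k" "0 \<le> L"
    and pos: "\<And>w. w \<in> J \<Longrightarrow> 0 \<le> \<rho>' w \<and> 1 \<le> \<sigma>' w"
    and le: "\<And>w i. w \<in> J \<Longrightarrow> i \<le> j \<Longrightarrow> \<rho> w * \<sigma> w ^ i \<le> L * (\<rho>' w * \<sigma>' w ^ i)"
  shows "scaled_C J \<sigma>' j \<rho>' \<phi>"
proof -
  obtain K where K: "0 \<le> K" "\<And>w i x. w \<in> I \<Longrightarrow> i \<le> k \<Longrightarrow> x \<in> {0..a} \<Longrightarrow>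
       norm (iter_deriv_on {0..a} i (\<phi> w) x) \<le> K * (\<rho> w * \<sigma> w ^ i)"
    by (rule scaled_C_E[OF F]) blast
  have "norm (iter_deriv_on {0..a} i (\<phi> w) x) \<le> (K * L) * (\<rho>' w * \<sigma>' w ^ i)"
    if "w \<in> J" "i \<le> j" "x \<in> {0..a}" for w i x
  proof -
    have "norm (iter_deriv_on {0..a} i (\<phi> w) x) \<le> K * (\<rho> w * \<sigma> w ^ i)"
      using that assms by (intro K) auto
    also have "\<dots> \<le> K * (L * (\<rho>' w * \<sigma>' w ^ i))"
      using K(1) le that by (intro mult_left_mono) auto
    finally show ?thesis by (simp add: mult.assoc)
  qed
  moreover have "C_on j {0..a} (\<phi> w)" if "w \<in> J" for w
    using scaled_C_D(3)[OF F, of w] assms(2,3) that C_on_le[of k "{0..a}" "\<phi> w" j] by auto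
  ultimately show ?thesis
    using pos K(1) assms(4) by (intro scaled_C_I[of "K * L"]) auto
qed

lemma scaled_C_le:
  assumes "scaled_C I \<sigma> k \<rho> \<phi>" "j \<le> k"
  shows "scaled_C I \<sigma> j \<rho> \<phi>"
  by (rule scaled_C_weaken[OF assms(1) order_refl assms(2), of 1])
     (use scaled_C_D[OF assms(1)] in auto)

lemma scaled_C_const:
  assumes "0 \<le> L" and "\<And>w. w \<in> I \<Longrightarrow> 0 \<le> \<rho> w \<and> 1 \<le> \<sigma> w \<and> norm (s w) \<le> L * \<rho> w"
  shows "scaled_C I \<sigma> k \<rho> (\<lambda>w x. s w)"
  using assms
proof (induction k arbitrary: s L \<rho>)
  case 0
  then show ?case by (intro scaled_C_0_I[of L]) auto
next
  case (Suc k)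
  show ?case
  proof (rule scaled_C_SucI)
    show "scaled_C I \<sigma> 0 \<rho> (\<lambda>w x. s w)"
      using Suc.prems by (intro scaled_C_0_I[of L]) auto
    show "scaled_C I \<sigma> k (\<lambda>w. \<rho> w * \<sigma> w) (\<lambda>w x. 0)"
    proof (rule Suc.IH[of 0])
      fix w assume "w \<in> I"
      then show "0 \<le> \<rho> w * \<sigma> w \<and> 1 \<le> \<sigma> w \<and> norm (0 :: complex) \<le> 0 * (\<rho> w * \<sigma> w)"
        using Suc.prems(2)[of w] by (simp add: zero_le_mult_iff)
    qed simp
  qed auto
qed

lemma scaled_C_of_C_on:
  assumes "C_on k {0..a} f" and "\<And>w. w \<in> I \<Longrightarrow> 1 \<le> \<sigma> w \<and> 1 \<le> \<rho> w"
  shows "scaled_C I \<sigma> k \<rho> (\<lambda>w. f)"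
  using assms
proof (induction k arbitrary: f \<rho>)
  case 0
  have "bounded (f ` {0..a})"
    using 0(1) by (auto intro!: compact_imp_bounded compact_continuous_image)
  then obtain B where B: "norm (f x) \<le> B" if "x \<in> {0..a}" for x
    unfolding bounded_iff by (metis imageI)
  have B0: "0 \<le> B"
    using order_trans[OF norm_ge_zero B[of 0]] a_pos by simp
  show ?case
  proof (rule scaled_C_0_I[OF B0])
    fix w assume w: "w \<in> I"
    then show "0 \<le> \<rho> w \<and> 1 \<le> \<sigma> w \<and> continuous_on {0..a} f"
      using 0(1) 0(2)[of w] by simp
    fix x assume "x \<in> {0..a}"
    moreover have "B * 1 \<le> B * \<rho> w"
      using 0(2)[OF w] B0 by (intro mult_left_mono) auto
    ultimately show "norm (f x) \<le> B * \<rho> w"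
      using B[of x] by linarith
  qed
next
  case (Suc k)
  have rs: "1 \<le> \<sigma> w \<and> 1 \<le> \<rho> w * \<sigma> w" if "w \<in> I" for w
    using Suc.prems(2)[OF that] mult_mono[of 1 "\<rho> w" 1 "\<sigma> w"] by simp
  have f: "f differentiable_on {0..a}" "C_on k {0..a} (D f)"
    using Suc.prems(1) by (auto simp: C_on_Suc)
  show ?case
    unfolding scaled_C_Suc
  proof (intro conjI ballI)
    show "scaled_C I \<sigma> k (\<lambda>w. \<rho> w * \<sigma> w) (\<lambda>w. D f)"
      using f(2) rs by (rule Suc.IH)
    have "scaled_C I \<sigma> k \<rho> (\<lambda>w. f)"
      using C_on_Suc_imp_C_on[OF Suc.prems(1)] Suc.prems(2) by (rule Suc.IH)
    then show "scaled_C I \<sigma> 0 \<rho> (\<lambda>w. f)"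
      by (rule scaled_C_le) simp
  qed (use f in auto)
qed

lemma scaled_C_add:
  assumes "scaled_C I \<sigma> k \<rho> \<phi>" "scaled_C I \<sigma> k \<rho> \<psi>"
  shows "scaled_C I \<sigma> k \<rho> (\<lambda>w x. \<phi> w x + \<psi> w x)"
  using assms
proof (induction k arbitrary: \<phi> \<psi> \<rho>)
  case 0
  obtain K where K: "0 \<le> K" "\<And>w x. w \<in> I \<Longrightarrow> x \<in> {0..a} \<Longrightarrow> norm (\<phi> w x) \<le> K * \<rho> w"
    using 0(1) unfolding scaled_C_0 by blast
  obtain L where L: "0 \<le> L" "\<And>w x. w \<in> I \<Longrightarrow> x \<in> {0..a} \<Longrightarrow> norm (\<psi> w x) \<le> L * \<rho> w"
    using 0(2) unfolding scaled_C_0 by blast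
  have "norm (\<phi> w x + \<psi> w x) \<le> (K + L) * \<rho> w" if "w \<in> I" "x \<in> {0..a}" for w x
    using K(2)[OF that] L(2)[OF that] norm_triangle_ineq[of "\<phi> w x" "\<psi> w x"]
    by (simp add: distrib_right)
  moreover have "0 \<le> K + L" using K(1) L(1) by simp
  ultimately show ?case
    using scaled_C_D[OF 0(1)] scaled_C_D[OF 0(2)]
    by (intro scaled_C_0_I[of "K + L"]) (auto intro!: continuous_on_add)
next
  case (Suc k)
  note lower = scaled_C_le[OF Suc.prems(1), of k] scaled_C_le[OF Suc.prems(2), of k]
  show ?case
  proof (rule scaled_C_SucI)
    show "((\<lambda>x. \<phi> w x + \<psi> w x) has_vector_derivative D (\<phi> w) x + D (\<psi> w) x) (at x within {0..a})"
      if "w \<in> I" "x \<in> {0..a}" for w x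
      using that Suc.prems by (intro derivative_intros scaled_C_deriv)
    show "scaled_C I \<sigma> 0 \<rho> (\<lambda>w x. \<phi> w x + \<psi> w x)"
      by (rule scaled_C_le[OF Suc.IH]) (use lower in auto)
    show "scaled_C I \<sigma> k (\<lambda>w. \<rho> w * \<sigma> w) (\<lambda>w x. D (\<phi> w) x + D (\<psi> w) x)"
      using Suc.prems by (intro Suc.IH) (auto simp: scaled_C_Suc)
  qed
qed

lemma scaled_C_mult:
  assumes "scaled_C I \<sigma> k \<rho> \<phi>" "scaled_C I \<sigma> k \<tau> \<psi>"
  shows "scaled_C I \<sigma> k (\<lambda>w. \<rho> w * \<tau> w) (\<lambda>w x. \<phi> w x * \<psi> w x)"
  using assms
proof (induction k arbitrary: \<phi> \<psi> \<rho> \<tau>)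
  case 0
  obtain K where K: "0 \<le> K" "\<And>w x. w \<in> I \<Longrightarrow> x \<in> {0..a} \<Longrightarrow> norm (\<phi> w x) \<le> K * \<rho> w"
    using 0(1) unfolding scaled_C_0 by blast
  obtain L where L: "0 \<le> L" "\<And>w x. w \<in> I \<Longrightarrow> x \<in> {0..a} \<Longrightarrow> norm (\<psi> w x) \<le> L * \<tau> w"
    using 0(2) unfolding scaled_C_0 by blast
  have "norm (\<phi> w x * \<psi> w x) \<le> (K * L) * (\<rho> w * \<tau> w)" if "w \<in> I" "x \<in> {0..a}" for w x
  proof -
    have "norm (\<phi> w x * \<psi> w x) \<le> (K * \<rho> w) * (L * \<tau> w)"
      unfolding norm_mult
      by (rule mult_mono[OF K(2)[OF that] L(2)[OF that] order_trans[OF norm_ge_zero K(2)[OF that]]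
            norm_ge_zero])
    then show ?thesis by (simp add: mult_ac)
  qed
  moreover have "0 \<le> K * L" using K(1) L(1) by simp
  ultimately show ?case
    using scaled_C_D[OF 0(1)] scaled_C_D[OF 0(2)]
    by (intro scaled_C_0_I[of "K * L"]) (auto intro!: continuous_on_mult)
next
  case (Suc k)
  note lower = scaled_C_le[OF Suc.prems(1), of k] scaled_C_le[OF Suc.prems(2), of k]
  show ?case
  proof (rule scaled_C_SucI)
    show "((\<lambda>x. \<phi> w x * \<psi> w x) has_vector_derivative
        \<phi> w x * D (\<psi> w) x + D (\<phi> w) x * \<psi> w x) (at x within {0..a})"
      if "w \<in> I" "x \<in> {0..a}" for w x
      using that Suc.prems by (intro derivative_intros scaled_C_deriv)
    show "scaled_C I \<sigma> 0 (\<lambda>w. \<rho> w * \<tau> w) (\<lambda>w x. \<phi> w x * \<psi> w x)"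
      by (rule scaled_C_le[OF Suc.IH]) (use lower in auto)
    have "scaled_C I \<sigma> k (\<lambda>w. \<rho> w * (\<tau> w * \<sigma> w)) (\<lambda>w x. \<phi> w x * D (\<psi> w) x)"
      using Suc.prems lower by (intro Suc.IH) (auto simp: scaled_C_Suc)
    moreover have "scaled_C I \<sigma> k (\<lambda>w. (\<rho> w * \<sigma> w) * \<tau> w) (\<lambda>w x. D (\<phi> w) x * \<psi> w x)"
      using Suc.prems lower by (intro Suc.IH) (auto simp: scaled_C_Suc)
    ultimately show "scaled_C I \<sigma> k (\<lambda>w. \<rho> w * \<tau> w * \<sigma> w)
        (\<lambda>w x. \<phi> w x * D (\<psi> w) x + D (\<phi> w) x * \<psi> w x)"
      by (intro scaled_C_add) (simp_all add: mult_ac)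
  qed
qed

end

section \<open>Products, powers and exponentials\<close>

lemma has_vector_derivative_exp_phase:
  assumes "((\<lambda>x. complex_of_real (g x)) has_vector_derivative g') (at x within S)"
  shows "((\<lambda>x. exp (\<i> * of_real w * of_real (g x))) has_vector_derivative
    \<i> * of_real w * g' * exp (\<i> * of_real w * of_real (g x))) (at x within S)"
proof -
  have "(exp \<circ> (\<lambda>x. \<i> * of_real w * of_real (g x)) has_vector_derivative
      (\<i> * of_real w * g') * exp (\<i> * of_real w * of_real (g x))) (at x within S)"
    by (rule field_vector_diff_chain_within[OF has_vector_derivative_mult_right[OF assms]
          has_field_derivative_at_within[OF DERIV_exp]])
  then show ?thesis by (simp add: o_def)
qed

lemma has_vector_derivative_of_real_powr:
  assumes d: "((\<lambda>x. complex_of_real (r x)) has_vector_derivative r') (at x within S)"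
    and r: "\<And>y. y \<in> S \<Longrightarrow> 0 < r y" and x: "x \<in> S"
  shows "((\<lambda>x. complex_of_real (r x powr \<beta>)) has_vector_derivative
    r' * (of_real \<beta> * of_real (r x powr (\<beta> - 1)))) (at x within S)"
proof (rule has_vector_derivative_transform[OF x])
  have "complex_of_real (r x) \<notin> \<real>\<^sub>\<le>\<^sub>0"
    using r[OF x] by (simp add: complex_nonpos_Reals_iff)
  then have "((\<lambda>z. z powr of_real \<beta>) has_field_derivative
      of_real \<beta> * of_real (r x) powr (of_real \<beta> - 1)) (at (complex_of_real (r x)))"
    by (rule has_field_derivative_powr)
  moreover have "complex_of_real (r x) powr (of_real \<beta> - 1) = of_real (r x powr (\<beta> - 1))"
    using powr_of_real[of "r x" "\<beta> - 1"] r[OF x] by simp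
  ultimately show "((\<lambda>z. z powr of_real \<beta>) \<circ> (\<lambda>x. complex_of_real (r x)) has_vector_derivative
      r' * (of_real \<beta> * of_real (r x powr (\<beta> - 1)))) (at x within S)"
    by (intro field_vector_diff_chain_within d) (simp add: has_field_derivative_at_within)
  show "complex_of_real (r y powr \<beta>) = ((\<lambda>z. z powr of_real \<beta>) \<circ> (\<lambda>x. complex_of_real (r x))) y"
    if "y \<in> S" for y
    using powr_of_real[of "r y" \<beta>] r[OF that] by simp
qed

context positive_interval
begin

text \<open>
  A single function is a family over a one-element index set, so that Leibniz' rule for
  families also gives the one for the classes \<open>C_on\<close>.
\<close>

lemma C_on_mult:
  fixes f g :: "real \<Rightarrow> complex"
  assumes "C_on k {0..a} f" and "C_on k {0..a} g"
  shows "C_on k {0..a} (\<lambda>x. f x * g x)"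
proof -
  have "scaled_C {()} (\<lambda>_. 1) k (\<lambda>_. 1) (\<lambda>w. f)" "scaled_C {()} (\<lambda>_. 1) k (\<lambda>_. 1) (\<lambda>w. g)"
    using assms by (auto intro: scaled_C_of_C_on)
  from scaled_C_D(3)[OF scaled_C_mult[OF this], of "()"] show ?thesis by simp
qed

lemma C_on_add:
  fixes f g :: "real \<Rightarrow> complex"
  assumes "C_on k {0..a} f" and "C_on k {0..a} g"
  shows "C_on k {0..a} (\<lambda>x. f x + g x)"
proof -
  have "scaled_C {()} (\<lambda>_. 1) k (\<lambda>_. 1) (\<lambda>w. f)" "scaled_C {()} (\<lambda>_. 1) k (\<lambda>_. 1) (\<lambda>w. g)"
    using assms by (auto intro: scaled_C_of_C_on)
  from scaled_C_D(3)[OF scaled_C_add[OF this], of "()"] show ?thesis by simp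
qed

lemma C_on_const: "C_on k {0..a} (\<lambda>x. c :: complex)"
proof -
  have "scaled_C {()} (\<lambda>_. 1) k (\<lambda>_. 1) (\<lambda>w x. c)"
    by (rule scaled_C_const[of "norm c"]) auto
  from scaled_C_D(3)[OF this, of "()"] show ?thesis by simp
qed

lemma C_on_powr:
  assumes "C_on k {0..a} (\<lambda>x. complex_of_real (r x))" and r: "\<And>x. x \<in> {0..a} \<Longrightarrow> 0 < r x"
  shows "C_on k {0..a} (\<lambda>x. complex_of_real (r x powr \<beta>))"
  using assms(1)
proof (induction k arbitrary: \<beta>)
  case 0
  have "continuous_on {0..a} (\<lambda>x. Re (complex_of_real (r x)))"
    using 0 by (intro continuous_intros) simp
  moreover have "\<forall>x\<in>{0..a}. r x \<noteq> 0"
    using r by force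
  ultimately have "continuous_on {0..a} (\<lambda>x. complex_of_real (r x powr \<beta>))"
    by (intro continuous_intros) auto
  then show ?case by simp
next
  case (Suc k)
  show ?case
  proof (rule C_on_SucI)
    show "((\<lambda>x. complex_of_real (r x powr \<beta>)) has_vector_derivative
        D (\<lambda>x. complex_of_real (r x)) x * (of_real \<beta> * of_real (r x powr (\<beta> - 1))))
        (at x within {0..a})" if "x \<in> {0..a}" for x
      using C_on_Suc_deriv[OF Suc.prems that] r that
      by (rule has_vector_derivative_of_real_powr)
    show "C_on k {0..a} (\<lambda>x. D (\<lambda>x. complex_of_real (r x)) x *
        (of_real \<beta> * of_real (r x powr (\<beta> - 1))))"
      using Suc.prems C_on_Suc_imp_C_on[OF Suc.prems]
      by (intro C_on_mult C_on_const Suc.IH) (simp_all add: C_on_Suc)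
  qed
qed

text \<open>
  The phase is real, so the exponential has modulus \<open>1\<close>, and its derivative is itself times
  \<open>\<i> w \<gamma>\<close>, which contributes one factor \<open>1 + w\<close> for each order.
\<close>

lemma scaled_C_exp:
  assumes g: "\<And>x. x \<in> {0..a} \<Longrightarrow>
      ((\<lambda>x. complex_of_real (g x)) has_vector_derivative \<gamma> x) (at x within {0..a})"
    and "C_on k {0..a} \<gamma>"
  shows "scaled_C {0<..} (\<lambda>w. 1 + w) k (\<lambda>w. 1) (\<lambda>w x. exp (\<i> * of_real w * of_real (g x)))"
  using assms(2)
proof (induction k)
  case 0
  have "continuous_on {0..a} (\<lambda>x. complex_of_real (g x))"
    using g by (rule continuous_on_vector_derivative)
  moreover have "norm (exp (\<i> * of_real w * of_real (g x))) = 1" for w x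
    using norm_exp_i_times[of "w * g x"] by (simp add: mult.assoc)
  ultimately show ?case
    by (intro scaled_C_0_I[of 1]) (auto intro!: continuous_intros)
next
  case (Suc k)
  show ?case
  proof (rule scaled_C_SucI)
    show "((\<lambda>x. exp (\<i> * of_real w * of_real (g x))) has_vector_derivative
        \<i> * of_real w * (\<gamma> x * exp (\<i> * of_real w * of_real (g x)))) (at x within {0..a})"
      if "x \<in> {0..a}" for w x
      using has_vector_derivative_exp_phase[OF g[OF that]] by (simp add: mult.assoc)
    have IH: "scaled_C {0<..} (\<lambda>w. 1 + w) k (\<lambda>w. 1) (\<lambda>w x. exp (\<i> * of_real w * of_real (g x)))"
      by (rule Suc.IH[OF C_on_Suc_imp_C_on[OF Suc.prems]])
    then show "scaled_C {0<..} (\<lambda>w. 1 + w) 0 (\<lambda>w. 1) (\<lambda>w x. exp (\<i> * of_real w * of_real (g x)))"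
      by (rule scaled_C_le) simp
    have "scaled_C {0<..} (\<lambda>w. 1 + w) k (\<lambda>w. 1 + w) (\<lambda>w x. \<i> * of_real w)"
      by (rule scaled_C_const[of 1]) (auto simp: norm_mult)
    moreover have "scaled_C {0<..} (\<lambda>w. 1 + w) k (\<lambda>w. 1) (\<lambda>w. \<gamma>)"
      using C_on_Suc_imp_C_on[OF Suc.prems] by (rule scaled_C_of_C_on) auto
    ultimately have "scaled_C {0<..} (\<lambda>w. 1 + w) k (\<lambda>w. (1 + w) * (1 * 1))
        (\<lambda>w x. \<i> * of_real w * (\<gamma> x * exp (\<i> * of_real w * of_real (g x))))"
      by (intro scaled_C_mult IH)
    then show "scaled_C {0<..} (\<lambda>w. 1 + w) k (\<lambda>w. 1 * (1 + w))
        (\<lambda>w x. \<i> * of_real w * (\<gamma> x * exp (\<i> * of_real w * of_real (g x))))"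
      by simp
  qed
qed

end

section \<open>Averages over dilations\<close>

text \<open>
  This is \<open>(1 / p) \<integral>\<^sub>0\<^sup>1 u powr (1 / p - 1 + m) \<psi>(u x) du\<close> after the substitution
  \<open>u = v powr p\<close>. The substitution removes the singularity that the weight has at \<open>0\<close>
  when \<open>p > 1\<close>, and leaves an integrand that is continuous on the closed square.
\<close>

definition dilation_mean :: "real \<Rightarrow> nat \<Rightarrow> (real \<Rightarrow> complex) \<Rightarrow> real \<Rightarrow> complex"
  where "dilation_mean p m \<psi> x =
    integral {0..1} (\<lambda>v. of_real ((v powr p) ^ m) * \<psi> (v powr p * x))"

lemma dilation_mean_cmult:
  "dilation_mean p m (\<lambda>y. c * \<psi> y) x = c * dilation_mean p m \<psi> x"
proof -
  have "(\<lambda>v. complex_of_real ((v powr p) ^ m) * (c * \<psi> (v powr p * x))) =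
      (\<lambda>v. c * (complex_of_real ((v powr p) ^ m) * \<psi> (v powr p * x)))"
    by (simp add: mult_ac)
  then show ?thesis by (simp add: dilation_mean_def)
qed

lemma powr_Icc_01:
  fixes p v :: real
  assumes "0 < p" and "v \<in> {0..1}"
  shows "0 \<le> v powr p" and "v powr p \<le> 1"
  using assms powr_le1[of p v] by auto

context positive_interval
begin

lemma dilate_in_Icc:
  assumes "0 < p" and "v \<in> {0..1}" and "x \<in> {0..a}"
  shows "v powr p * x \<in> {0..a}"
  using powr_Icc_01[OF assms(1,2)] assms(3) mult_mono[of "v powr p" 1 x a] by auto

lemma continuous_on_dilation_integrand:
  assumes "0 < p" and "continuous_on {0..a} \<psi>"
  shows "continuous_on ({0..a} \<times> {0..1})
    (\<lambda>(x, v). complex_of_real ((v powr p) ^ m) * \<psi> (v powr p * x))"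
proof -
  have "continuous_on ({0..a} \<times> {0..1::real}) (\<lambda>z. snd z powr p)"
    using assms(1) by (intro continuous_on_powr' continuous_intros) auto
  moreover from this have "continuous_on ({0..a} \<times> {0..1}) (\<lambda>z. \<psi> (snd z powr p * fst z))"
  proof (intro continuous_on_compose2[OF assms(2)])
    assume "continuous_on ({0..a} \<times> {0..1::real}) (\<lambda>z. snd z powr p)"
    then show "continuous_on ({0..a} \<times> {0..1}) (\<lambda>z. snd z powr p * fst z)"
      by (rule continuous_on_mult) (intro continuous_intros)
    show "(\<lambda>z. snd z powr p * fst z) ` ({0..a} \<times> {0..1}) \<subseteq> {0..a}"
      using dilate_in_Icc[OF assms(1)] by fastforce
  qed
  ultimately have "continuous_on ({0..a} \<times> {0..1})
      (\<lambda>z. complex_of_real ((snd z powr p) ^ m) * \<psi> (snd z powr p * fst z))"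
    by (intro continuous_on_mult continuous_on_of_real continuous_on_power)
  then show ?thesis by (simp add: case_prod_unfold)
qed

lemma continuous_on_dilation_slice:
  assumes "0 < p" and "continuous_on {0..a} \<psi>" and "x \<in> {0..a}"
  shows "continuous_on {0..1} (\<lambda>v. complex_of_real ((v powr p) ^ m) * \<psi> (v powr p * x))"
proof -
  have "continuous_on {0..1::real} (\<lambda>v. (x, v))" "Pair x ` {0..1::real} \<subseteq> {0..a} \<times> {0..1}"
    using assms(3) by (auto intro: continuous_intros)
  from continuous_on_compose2[OF continuous_on_dilation_integrand[OF assms(1,2), of m] this]
  show ?thesis by simp
qed

lemma continuous_on_dilation_mean:
  assumes "0 < p" and "continuous_on {0..a} \<psi>"
  shows "continuous_on {0..a} (dilation_mean p m \<psi>)"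
  using integral_continuous_on_param[of "{0..a}" 0 1
      "\<lambda>x v. complex_of_real ((v powr p) ^ m) * \<psi> (v powr p * x)"]
    continuous_on_dilation_integrand[OF assms, of m]
  unfolding dilation_mean_def[abs_def] by (simp add: box_real)

lemma norm_dilation_mean_le:
  assumes "0 < p" and "continuous_on {0..a} \<psi>" and "x \<in> {0..a}"
    and B: "\<And>y. y \<in> {0..a} \<Longrightarrow> norm (\<psi> y) \<le> B"
  shows "norm (dilation_mean p m \<psi> x) \<le> B"
proof -
  have "norm (complex_of_real ((v powr p) ^ m) * \<psi> (v powr p * x)) \<le> B" if "v \<in> {0..1}" for v
  proof -
    have "norm (complex_of_real ((v powr p) ^ m)) \<le> 1"
      using powr_Icc_01[OF assms(1) that] by (simp add: norm_power power_le_one)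
    moreover have "norm (\<psi> (v powr p * x)) \<le> B"
      using dilate_in_Icc[OF assms(1) that assms(3)] by (rule B)
    ultimately have "norm (complex_of_real ((v powr p) ^ m)) * norm (\<psi> (v powr p * x)) \<le> 1 * B"
      by (intro mult_mono) auto
    then show ?thesis by (simp add: norm_mult)
  qed
  then have "norm (integral {0..1} (\<lambda>v. complex_of_real ((v powr p) ^ m) * \<psi> (v powr p * x)))
      \<le> B * (1 - 0)"
    using continuous_on_dilation_slice[OF assms(1-3)] by (intro integral_bound) auto
  then show ?thesis by (simp add: dilation_mean_def)
qed

text \<open>
  The chain rule produces the dilation factor \<open>v powr p\<close>, which raises \<open>m\<close> by one.
\<close>

lemma has_vector_derivative_dilation_mean:
  assumes p: "0 < p"
    and d: "\<And>x. x \<in> {0..a} \<Longrightarrow> (\<psi> has_vector_derivative \<psi>' x) (at x within {0..a})"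
    and c: "continuous_on {0..a} \<psi>'" and x: "x \<in> {0..a}"
  shows "(dilation_mean p m \<psi> has_vector_derivative dilation_mean p (Suc m) \<psi>' x) (at x within {0..a})"
proof -
  have cont: "continuous_on {0..a} \<psi>"
    using d by (rule continuous_on_vector_derivative)
  have "((\<lambda>x. integral (cbox 0 1) (\<lambda>v. complex_of_real ((v powr p) ^ m) * \<psi> (v powr p * x)))
      has_vector_derivative integral (cbox 0 1)
        (\<lambda>v. complex_of_real ((v powr p) ^ Suc m) * \<psi>' (v powr p * x))) (at x within {0..a})"
  proof (rule leibniz_rule_vector_derivative)
    fix y v :: real assume y: "y \<in> {0..a}" and v: "v \<in> cbox 0 1"
    have "((\<psi> \<circ> (\<lambda>y. v powr p * y)) has_vector_derivative (v powr p) *\<^sub>R \<psi>' (v powr p * y))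
        (at y within {0..a})"
    proof (rule vector_diff_chain_within)
      have "((\<lambda>y. v powr p * y) has_field_derivative v powr p) (at y within {0..a})"
        by (auto intro!: derivative_eq_intros)
      then show "((\<lambda>y. v powr p * y) has_vector_derivative v powr p) (at y within {0..a})"
        by (simp add: has_real_derivative_iff_has_vector_derivative)
      have "(\<lambda>y. v powr p * y) ` {0..a} \<subseteq> {0..a}"
        using dilate_in_Icc[OF p] v by auto
      then show "(\<psi> has_vector_derivative \<psi>' (v powr p * y))
          (at (v powr p * y) within (\<lambda>y. v powr p * y) ` {0..a})"
        using d dilate_in_Icc[OF p _ y, of v] v by (auto intro: has_vector_derivative_within_subset)
    qed
    then have "((\<lambda>y. complex_of_real ((v powr p) ^ m) * \<psi> (v powr p * y)) has_vector_derivative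
        complex_of_real ((v powr p) ^ m) * ((v powr p) *\<^sub>R \<psi>' (v powr p * y))) (at y within {0..a})"
      unfolding o_def by (rule has_vector_derivative_mult_right)
    then show "((\<lambda>y. complex_of_real ((v powr p) ^ m) * \<psi> (v powr p * y)) has_vector_derivative
        complex_of_real ((v powr p) ^ Suc m) * \<psi>' (v powr p * y)) (at y within {0..a})"
      by (simp add: scaleR_conv_of_real mult_ac)
  next
    show "(\<lambda>v. complex_of_real ((v powr p) ^ m) * \<psi> (v powr p * y)) integrable_on cbox 0 1"
      if "y \<in> {0..a}" for y
      using continuous_on_dilation_slice[OF p cont that]
      by (intro integrable_continuous) (simp add: box_real)
    show "continuous_on ({0..a} \<times> cbox 0 1)
        (\<lambda>(x, v). complex_of_real ((v powr p) ^ Suc m) * \<psi>' (v powr p * x))"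
      using continuous_on_dilation_integrand[OF p c, of "Suc m"] by (simp only: box_real)
  qed (use x in auto)
  then show ?thesis
    unfolding dilation_mean_def[abs_def] by (simp only: box_real)
qed

text \<open>
  Differentiation under the integral keeps all weights in \<open>[0, 1]\<close>, so that a bound on \<open>\<phi> w\<close> or
  on one of its derivatives is inherited by the mean.
\<close>

lemma scaled_C_dilation_mean:
  assumes "0 < p" and "scaled_C I \<sigma> k \<rho> \<phi>"
  shows "scaled_C I \<sigma> k \<rho> (\<lambda>w. dilation_mean p m (\<phi> w))"
  using assms(2)
proof (induction k arbitrary: m \<rho> \<phi>)
  case 0
  obtain K where "0 \<le> K" and K: "\<And>w x. w \<in> I \<Longrightarrow> x \<in> {0..a} \<Longrightarrow> norm (\<phi> w x) \<le> K * \<rho> w"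
    using 0 unfolding scaled_C_0 by blast
  then show ?case
    using scaled_C_D[OF 0] assms(1)
    by (intro scaled_C_0_I[of K] norm_dilation_mean_le) (auto intro!: continuous_on_dilation_mean)
next
  case (Suc k)
  have d: "scaled_C I \<sigma> k (\<lambda>w. \<rho> w * \<sigma> w) (\<lambda>w. D (\<phi> w))"
    using Suc.prems by (simp add: scaled_C_Suc)
  show ?case
  proof (rule scaled_C_SucI)
    show "(dilation_mean p m (\<phi> w) has_vector_derivative dilation_mean p (Suc m) (D (\<phi> w)) x)
        (at x within {0..a})" if "w \<in> I" "x \<in> {0..a}" for w x
      using scaled_C_deriv[OF Suc.prems that(1)] that(2) assms(1)
        C_on_imp_continuous_on[OF scaled_C_D(3)[OF d that(1)]]
      by (intro has_vector_derivative_dilation_mean)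
    show "scaled_C I \<sigma> 0 \<rho> (\<lambda>w. dilation_mean p m (\<phi> w))"
      by (rule scaled_C_le[OF Suc.IH[OF scaled_C_le[OF Suc.prems]]]) auto
    show "scaled_C I \<sigma> k (\<lambda>w. \<rho> w * \<sigma> w) (\<lambda>w. dilation_mean p (Suc m) (D (\<phi> w)))"
      by (rule Suc.IH[OF d])
  qed
qed

lemma C_on_dilation_mean:
  assumes "0 < p" and "C_on k {0..a} f"
  shows "C_on k {0..a} (dilation_mean p m f)"
proof -
  have "scaled_C {()} (\<lambda>_. 1) k (\<lambda>_. 1) (\<lambda>w. f)"
    using assms(2) by (auto intro: scaled_C_of_C_on)
  from scaled_C_D(3)[OF scaled_C_dilation_mean[OF assms(1) this], of "()"] show ?thesis by simp
qed

text \<open>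
  The derivative of \<open>v Y(v powr p x)\<close> with respect to \<open>v\<close> is \<open>\<psi>(v powr p x)\<close>: the mean inverts the
  Euler operator \<open>p x d/dx + 1\<close>. The derivative of \<open>Y\<close> is used only away from \<open>0\<close>, since the lemma
  will be applied to a difference quotient at \<open>0\<close> of a function that is only once differentiable.
\<close>

lemma dilation_mean_eqI:
  assumes p: "0 < p" and Y: "continuous_on {0..a} Y"
    and d: "\<And>x. x \<in> {0<..a} \<Longrightarrow> (Y has_vector_derivative Y' x) (at x within {0..a})"
    and eq: "\<And>x. x \<in> {0..a} \<Longrightarrow> of_real (p * x) * Y' x + Y x = \<psi> x"
    and x: "x \<in> {0..a}"
  shows "dilation_mean p 0 \<psi> x = Y x"
proof (cases "x = 0")
  case True
  then show ?thesis using eq[of 0] a_pos by (simp add: dilation_mean_def)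
next
  case False
  have pos: "0 < x" "x \<le> a" using False x by auto
  have "((\<lambda>v. \<psi> (v powr p * x)) has_integral
      of_real 1 * Y (1 powr p * x) - of_real 0 * Y (0 powr p * x)) {0..1}"
  proof (rule fundamental_theorem_of_calculus_interior)
    have "continuous_on {0..1} (\<lambda>v. Y (v powr p * x))"
      using continuous_on_dilation_slice[OF p Y x, of 0] by simp
    then show "continuous_on {0..1} (\<lambda>v. of_real v * Y (v powr p * x))"
      by (intro continuous_intros)
  next
    fix v :: real assume v: "v \<in> {0<..<1}"
    define y where "y = v powr p * x"
    have "v powr p < 1" using v p powr_less_mono2[of p v 1] by simp
    then have "v powr p * x < 1 * x"
      using pos(1) by (rule mult_strict_right_mono)
    then have "y < a"
      unfolding y_def using pos(2) by linarith
    moreover have "0 < y"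
      unfolding y_def using v pos(1) by (intro mult_pos_pos) auto
    ultimately have y: "y \<in> {0<..<a}"
      by simp
    then have "at y within {0..a} = at y"
      by (intro at_within_interior) auto
    then have dY: "(Y has_vector_derivative Y' y) (at y)"
      using d[of y] y by simp
    have "((\<lambda>v. v powr p * x) has_field_derivative p * v powr (p - 1) * x) (at v)"
      using v by (auto intro!: derivative_eq_intros)
    then have "((\<lambda>v. v powr p * x) has_vector_derivative p * v powr (p - 1) * x) (at v)"
      by (simp add: has_real_derivative_iff_has_vector_derivative)
    then have "((Y \<circ> (\<lambda>v. v powr p * x)) has_vector_derivative (p * v powr (p - 1) * x) *\<^sub>R Y' y) (at v)"
      using dY unfolding y_def by (rule vector_diff_chain_at)
    then have "((\<lambda>v. of_real v * Y (v powr p * x)) has_vector_derivative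
        of_real v * ((p * v powr (p - 1) * x) *\<^sub>R Y' y) + of_real 1 * Y y) (at v)"
      unfolding o_def y_def by (intro derivative_intros) (auto intro!: derivative_intros)
    moreover have "of_real v * ((p * v powr (p - 1) * x) *\<^sub>R Y' y) + of_real 1 * Y y = \<psi> y"
    proof -
      have "v * v powr (p - 1) = v powr p"
        using v powr_mult_base[of v "p - 1"] by simp
      then have "v * (p * v powr (p - 1) * x) = p * y"
        by (simp add: y_def mult_ac)
      then have "of_real v * ((p * v powr (p - 1) * x) *\<^sub>R Y' y) = of_real (p * y) * Y' y"
        by (metis mult.assoc of_real_mult scaleR_conv_of_real)
      then show ?thesis using eq[of y] y by simp
    qed
    ultimately show "((\<lambda>v. of_real v * Y (v powr p * x)) has_vector_derivative \<psi> (v powr p * x)) (at v)"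
      by (simp add: y_def)
  qed simp
  then show ?thesis
    by (simp add: dilation_mean_def integral_unique)
qed

lemma dilation_mean_ode:
  assumes p: "0 < p" and C: "C_on (Suc 0) {0..a} \<psi>" and x: "x \<in> {0..a}"
  shows "of_real (p * x) * dilation_mean p 1 (D \<psi>) x + dilation_mean p 0 \<psi> x = \<psi> x"
proof -
  have cont: "continuous_on {0..a} (D \<psi>)" "continuous_on {0..a} \<psi>"
    using C C_on_imp_continuous_on[OF C] by (auto simp: C_on_Suc)
  have "dilation_mean p 0 (\<lambda>x. of_real (p * x) * D \<psi> x + \<psi> x) x = \<psi> x"
    using C_on_Suc_deriv[OF C] cont p x by (intro dilation_mean_eqI) auto
  moreover have "dilation_mean p 0 (\<lambda>x. of_real (p * x) * D \<psi> x + \<psi> x) x =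
      of_real (p * x) * dilation_mean p 1 (D \<psi>) x + dilation_mean p 0 \<psi> x"
  proof -
    have "((\<lambda>v. of_real (p * x) * (of_real ((v powr p) ^ 1) * D \<psi> (v powr p * x)) +
          of_real ((v powr p) ^ 0) * \<psi> (v powr p * x))
        has_integral of_real (p * x) * dilation_mean p 1 (D \<psi>) x + dilation_mean p 0 \<psi> x) {0..1}"
      unfolding dilation_mean_def
      by (intro has_integral_add has_integral_mult_right integrable_integral
            integrable_continuous_real continuous_on_dilation_slice cont p x)
    then show ?thesis
      by (simp add: dilation_mean_def integral_unique mult_ac)
  qed
  ultimately show ?thesis by simp
qed

text \<open>
  For \<open>p = 1\<close> the mean of the derivative is the difference quotient at \<open>0\<close>, extended continuously.
  This shows that the quotient loses exactly one order of differentiability.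
\<close>

lemma dilation_mean_deriv_eq_diff:
  assumes C: "C_on (Suc 0) {0..a} f" and x: "x \<in> {0..a}"
  shows "of_real x * dilation_mean 1 0 (D f) x = f x - f 0"
proof -
  have sub: "(\<lambda>v. v * x) ` {0..1} \<subseteq> {0..a}"
    using dilate_in_Icc[of 1 _ x] x by auto
  have "((\<lambda>v. x *\<^sub>R D f (v * x)) has_integral f (1 * x) - f (0 * x)) {0..1}"
  proof (rule fundamental_theorem_of_calculus)
    fix v :: real assume v: "v \<in> {0..1}"
    have "((f \<circ> (\<lambda>v. v * x)) has_vector_derivative x *\<^sub>R D f (v * x)) (at v within {0..1})"
    proof (rule vector_diff_chain_within)
      have "((\<lambda>v. v * x) has_field_derivative x) (at v within {0..1})"
        by (auto intro!: derivative_eq_intros)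
      then show "((\<lambda>v. v * x) has_vector_derivative x) (at v within {0..1})"
        by (simp add: has_real_derivative_iff_has_vector_derivative)
      show "(f has_vector_derivative D f (v * x)) (at (v * x) within (\<lambda>v. v * x) ` {0..1})"
      proof (rule has_vector_derivative_within_subset[OF _ sub])
        have "v * x \<in> {0..a}" using sub v by blast
        then show "(f has_vector_derivative D f (v * x)) (at (v * x) within {0..a})"
          by (rule C_on_Suc_deriv[OF C])
      qed
    qed
    then show "((\<lambda>v. f (v * x)) has_vector_derivative x *\<^sub>R D f (v * x)) (at v within {0..1})"
      by (simp add: o_def)
  qed simp
  moreover have "integral {0..1} (\<lambda>v. x *\<^sub>R D f (v * x)) = of_real x * dilation_mean 1 0 (D f) x"
  proof -
    have "integral {0..1} (\<lambda>v. D f (v powr 1 * x)) = integral {0..1} (\<lambda>v. D f (v * x))"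
      by (intro integral_cong) auto
    then show ?thesis by (simp add: dilation_mean_def scaleR_conv_of_real)
  qed
  moreover have "integral {0..1} (\<lambda>v. x *\<^sub>R D f (v * x)) = f (1 * x) - f (0 * x)"
    using calculation(1) by (rule integral_unique)
  ultimately show ?thesis by (simp only: mult_1 mult_zero_left)
qed

end

section \<open>The regular solution for a monotone phase\<close>

locale monotone_phase = positive_interval +
  fixes \<alpha> :: real and g :: "real \<Rightarrow> real" and m :: nat
  assumes \<alpha>: "-1 < \<alpha>"
    and g_C: "C_on (Suc (Suc m)) {0..a} g"
    and g_0: "g 0 = 0"
    and g'_pos: "\<And>x. x \<in> {0..a} \<Longrightarrow> 0 < D g x"
begin

definition \<gamma> :: "real \<Rightarrow> complex"
  where "\<gamma> x = of_real (D g x)"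

text \<open>
  The function \<open>h\<close> with \<open>g(x) = x h(x)\<close>.
\<close>

definition slope :: "real \<Rightarrow> real"
  where "slope x = (if x = 0 then D g 0 else g x / x)"

definition osc :: "real \<Rightarrow> real \<Rightarrow> complex"
  where "osc w x = exp (\<i> * of_real w * of_real (g x))"

definition weight :: "real \<Rightarrow> complex"
  where "weight x = of_real (slope x powr \<alpha>)"

definition coweight :: "real \<Rightarrow> complex"
  where "coweight x = of_real (slope x powr (- 1 - \<alpha>))"

text \<open>
  The exponent for which \<open>dilation_mean\<close> has the weight \<open>u powr \<alpha>\<close>.
\<close>

definition p :: real
  where "p = 1 / (1 + \<alpha>)"

text \<open>
  The solution of \<open>(g / g') q' + (1 + \<alpha> + \<i> w g) q = F\<close> that is regular at \<open>0\<close>: the variation of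
  constants formula after the substitution \<open>s = u x\<close>, in which the powers of \<open>x\<close> cancel.
\<close>

definition solution :: "real \<Rightarrow> (real \<Rightarrow> complex) \<Rightarrow> real \<Rightarrow> complex"
  where "solution w F x = of_real p * coweight x * osc (- w) x *
    dilation_mean p 0 (\<lambda>y. weight y * \<gamma> y * osc w y * F y) x"

text \<open>
  The leading term \<open>(F - F(0)) / (\<i> g)\<close> of the expansion in powers of \<open>1 / w\<close>, obtained by
  balancing \<open>F - F(0)\<close> with \<open>\<i> w g q\<close>. In this form it makes sense at \<open>0\<close>, too.
\<close>

definition amplitude :: "(real \<Rightarrow> complex) \<Rightarrow> real \<Rightarrow> complex"
  where "amplitude F x = - \<i> * of_real (slope x powr (- 1)) * dilation_mean 1 0 (D F) x"

text \<open>
  The right-hand side left over by the amplitude \<open>A\<close>, that is \<open>-((g / g') A' + (1 + \<alpha>) A)\<close>. Differentiating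
  \<open>\<i> g A = F - F(0)\<close> eliminates \<open>A'\<close>, so that only one derivative of \<open>F\<close> is lost, rather than two.
\<close>

definition residual :: "(real \<Rightarrow> complex) \<Rightarrow> real \<Rightarrow> complex"
  where "residual F x = \<i> * of_real (D g x powr (- 1)) * D F x + (- of_real \<alpha>) * amplitude F x"

lemma p_pos: "0 < p"
  using \<alpha> by (simp add: p_def)

lemma g_deriv:
  assumes "x \<in> {0..a}"
  shows "(g has_vector_derivative D g x) (at x within {0..a})"
  using C_on_Suc_deriv[OF g_C assms] .

lemma C_on_\<gamma>: "C_on (Suc m) {0..a} \<gamma>"
  using C_on_of_real[of "Suc m" "D g"] g_C unfolding \<gamma>_def[abs_def] C_on_Suc[of "Suc m"] by simp

lemma of_real_g_deriv:
  assumes "x \<in> {0..a}"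
  shows "((\<lambda>x. complex_of_real (g x)) has_vector_derivative \<gamma> x) (at x within {0..a})"
  unfolding \<gamma>_def using g_deriv[OF assms]
  by (rule bounded_linear.has_vector_derivative[OF bounded_linear_of_real])

lemma D_of_real_g: "x \<in> {0..a} \<Longrightarrow> D (\<lambda>x. complex_of_real (g x)) x = \<gamma> x"
  by (intro D_eqI of_real_g_deriv)

lemma of_real_slope:
  assumes x: "x \<in> {0..a}"
  shows "complex_of_real (slope x) = dilation_mean 1 0 \<gamma> x"
proof (cases "x = 0")
  case True
  then show ?thesis by (simp add: slope_def dilation_mean_def \<gamma>_def)
next
  case False
  have "C_on (Suc 0) {0..a} (\<lambda>x. complex_of_real (g x))"
    using C_on_of_real[OF C_on_le[OF g_C, of "Suc 0"]] by simp
  from dilation_mean_deriv_eq_diff[OF this x]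
  have "of_real x * dilation_mean 1 0 (D (\<lambda>x. complex_of_real (g x))) x = of_real (g x)"
    by (simp add: g_0)
  moreover have "dilation_mean 1 0 (D (\<lambda>x. complex_of_real (g x))) x = dilation_mean 1 0 \<gamma> x"
    unfolding dilation_mean_def
    using dilate_in_Icc[OF zero_less_one _ x] D_of_real_g by (intro integral_cong) simp
  ultimately show ?thesis
    using False by (simp add: slope_def field_simps)
qed

lemma slope_pos:
  assumes x: "x \<in> {0..a}"
  shows "0 < slope x"
proof (cases "x = 0")
  case True
  then show ?thesis using g'_pos[of 0] a_pos by (simp add: slope_def)
next
  case False
  then have "0 < x" using x by simp
  have "\<exists>\<xi>\<in>{0<..<x}. g x - g 0 = D g \<xi> * (x - 0)"
  proof (rule mvt_simple)
    show "0 < x" by fact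
    show "(g has_derivative (\<lambda>t. D g \<xi> * t)) (at \<xi> within {0..x})" if "0 \<le> \<xi>" "\<xi> \<le> x" for \<xi>
      using has_vector_derivative_within_subset[OF g_deriv[of \<xi>], of "{0..x}"] that x
      by (simp add: has_vector_derivative_def mult.commute[of _ "D g \<xi>"])
  qed
  then have "0 < g x"
    using g'_pos x \<open>0 < x\<close> g_0 by force
  then show ?thesis using \<open>0 < x\<close> by (simp add: slope_def)
qed

lemma g_eq: "g x = x * slope x"
  using g_0 by (simp add: slope_def)

lemma C_on_slope: "C_on (Suc m) {0..a} (\<lambda>x. complex_of_real (slope x))"
  using C_on_dilation_mean[OF zero_less_one C_on_\<gamma>, of 0]
    C_on_cong[of "{0..a}" "\<lambda>x. complex_of_real (slope x)" "dilation_mean 1 0 \<gamma>" "Suc m"]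
    of_real_slope by simp

lemma slope_deriv:
  assumes "x \<in> {0..a}"
  shows "((\<lambda>x. complex_of_real (slope x)) has_vector_derivative D (\<lambda>x. complex_of_real (slope x)) x)
    (at x within {0..a})"
  using C_on_Suc_deriv[OF C_on_slope assms] .

text \<open>
  This is the product rule for \<open>g(x) = x h(x)\<close>; it turns derivatives of the weights into \<open>g'\<close>.
\<close>

lemma slope_ode:
  assumes x: "x \<in> {0..a}"
  shows "of_real x * D (\<lambda>x. complex_of_real (slope x)) x + of_real (slope x) = \<gamma> x"
proof -
  have "((\<lambda>x. complex_of_real x * of_real (slope x)) has_vector_derivative
      of_real x * D (\<lambda>x. complex_of_real (slope x)) x + of_real 1 * of_real (slope x)) (at x within {0..a})"
    by (intro has_vector_derivative_mult slope_deriv[OF x] has_vector_derivative_of_real DERIV_ident)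
  then have "D (\<lambda>x. complex_of_real (g x)) x =
      of_real x * D (\<lambda>x. complex_of_real (slope x)) x + of_real 1 * of_real (slope x)"
    by (intro D_eqI x) (simp add: g_eq)
  then show ?thesis using D_of_real_g[OF x] by simp
qed

lemma C_on_powers:
  assumes "k \<le> Suc m"
  shows "C_on k {0..a} \<gamma>" "C_on k {0..a} weight" "C_on k {0..a} coweight"
    and "C_on k {0..a} (\<lambda>x. complex_of_real (slope x powr \<beta>))"
    and "C_on k {0..a} (\<lambda>x. complex_of_real (D g x powr \<beta>))"
proof -
  show 1: "C_on k {0..a} (\<lambda>x. complex_of_real (slope x powr \<beta>))" for \<beta>
    using C_on_le[OF C_on_slope assms] slope_pos by (rule C_on_powr)
  show "C_on k {0..a} weight" "C_on k {0..a} coweight"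
    unfolding weight_def[abs_def] coweight_def[abs_def] by (rule 1)+
  show 2: "C_on k {0..a} \<gamma>"
    using C_on_le[OF C_on_\<gamma> assms] .
  show "C_on k {0..a} (\<lambda>x. complex_of_real (D g x powr \<beta>))"
    using 2[unfolded \<gamma>_def[abs_def]] g'_pos by (rule C_on_powr)
qed

lemma weight_deriv:
  assumes x: "x \<in> {0..a}"
  shows "(weight has_vector_derivative
    of_real \<alpha> * weight x * D (\<lambda>x. complex_of_real (slope x)) x / of_real (slope x)) (at x within {0..a})"
proof -
  have "slope x powr (\<alpha> - 1) = slope x powr \<alpha> / slope x"
    using slope_pos[OF x] by (simp add: powr_diff)
  then show ?thesis
    using has_vector_derivative_of_real_powr[OF slope_deriv[OF x] slope_pos x, of \<alpha>]
    by (simp add: weight_def[abs_def] mult_ac)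
qed

lemma coweight_deriv:
  assumes x: "x \<in> {0..a}"
  shows "(coweight has_vector_derivative
    - (1 + of_real \<alpha>) * coweight x * D (\<lambda>x. complex_of_real (slope x)) x / of_real (slope x))
    (at x within {0..a})"
proof -
  have "slope x powr ((- 1 - \<alpha>) - 1) = slope x powr (- 1 - \<alpha>) / slope x"
    using slope_pos[OF x] powr_diff[of "slope x" "- 1 - \<alpha>" 1] by simp
  then show ?thesis
    using has_vector_derivative_of_real_powr[OF slope_deriv[OF x] slope_pos x, of "- 1 - \<alpha>"]
    by (simp add: coweight_def[abs_def] mult_ac)
qed

lemma coweight_weight:
  assumes "x \<in> {0..a}"
  shows "coweight x * of_real (slope x) * weight x = 1"
proof -
  have "slope x powr (- 1 - \<alpha>) * slope x powr 1 * slope x powr \<alpha> = 1"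
    using slope_pos[OF assms] by (simp only: powr_add[symmetric]) simp
  then show ?thesis
    using slope_pos[OF assms]
    unfolding coweight_def weight_def of_real_mult[symmetric] by simp
qed

lemma osc_deriv:
  assumes "x \<in> {0..a}"
  shows "(osc w has_vector_derivative \<i> * of_real w * \<gamma> x * osc w x) (at x within {0..a})"
unfolding osc_def[abs_def]
  using of_real_g_deriv[OF assms] by (rule has_vector_derivative_exp_phase)

lemma osc_uminus: "osc (- w) x * osc w x = 1"
  by (simp add: osc_def exp_add[symmetric])

lemma scaled_C_osc:
  assumes "k \<le> Suc m"
  shows "scaled_C {0<..} (\<lambda>w. 1 + w) k (\<lambda>w. 1) osc"
    and "scaled_C {0<..} (\<lambda>w. 1 + w) k (\<lambda>w. 1) (\<lambda>w. osc (- w))"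
proof -
  show "scaled_C {0<..} (\<lambda>w. 1 + w) k (\<lambda>w. 1) osc"
    unfolding osc_def[abs_def]
    using of_real_g_deriv C_on_powers(1)[OF assms] by (rule scaled_C_exp)
  have "scaled_C {0<..} (\<lambda>w. 1 + w) k (\<lambda>w. 1) (\<lambda>w x. exp (\<i> * of_real w * of_real (- g x)))"
  proof (rule scaled_C_exp)
    show "((\<lambda>x. complex_of_real (- g x)) has_vector_derivative (- 1) * \<gamma> x) (at x within {0..a})"
      if "x \<in> {0..a}" for x
      using has_vector_derivative_minus[OF of_real_g_deriv[OF that]] by simp
    show "C_on k {0..a} (\<lambda>x. (- 1) * \<gamma> x)"
      by (intro C_on_mult C_on_const C_on_powers(1) assms)
  qed
  then show "scaled_C {0<..} (\<lambda>w. 1 + w) k (\<lambda>w. 1) (\<lambda>w. osc (- w))"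
    by (simp add: osc_def[abs_def])
qed

lemma C_on_osc:
  assumes "k \<le> Suc m"
  shows "C_on k {0..a} (osc w)"
\<comment> \<open>The families are indexed by positive frequencies; a negative one is covered by the conjugate oscillation.\<close>
proof (cases w "0 :: real" rule: linorder_cases)
  case less
  then show ?thesis using scaled_C_D(3)[OF scaled_C_osc(2)[OF assms], of "- w"] by simp
next
  case equal
  then show ?thesis using C_on_const[of k 1] by (simp add: osc_def[abs_def])
next
  case greater
  then show ?thesis using scaled_C_D(3)[OF scaled_C_osc(1)[OF assms], of w] by simp
qed

text \<open>
  Without a choice of the constant, the solution stays bounded, but each derivative may cost a factor
  \<open>1 + w\<close> because of the two oscillating factors.
\<close>

lemma scaled_C_solution:
  assumes F: "C_on k {0..a} F" and k: "k \<le> Suc m"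
  shows "scaled_C {0<..} (\<lambda>w. 1 + w) k (\<lambda>w. 1) (\<lambda>w. solution w F)"
proof -
  have single: "scaled_C {0<..} (\<lambda>w. 1 + w) k (\<lambda>w. 1) (\<lambda>w. f)" if "C_on k {0..a} f" for f
    using that by (rule scaled_C_of_C_on) auto
  have "scaled_C {0<..} (\<lambda>w. 1 + w) k (\<lambda>w. 1 * 1 * 1 * 1) (\<lambda>w x. weight x * \<gamma> x * osc w x * F x)"
    by (intro scaled_C_mult single scaled_C_osc C_on_powers F k)
  then have "scaled_C {0<..} (\<lambda>w. 1 + w) k (\<lambda>w. 1 * 1 * 1 * (1 * 1 * 1 * 1)) (\<lambda>w x. of_real p * coweight x * osc (- w) x *
      dilation_mean p 0 (\<lambda>y. weight y * \<gamma> y * osc w y * F y) x)"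
    by (intro scaled_C_mult single C_on_const scaled_C_osc C_on_powers F k
          scaled_C_dilation_mean p_pos)
  then show ?thesis
    unfolding solution_def[abs_def] by simp
qed

lemma continuous_on_solution_integrand:
  assumes "continuous_on {0..a} F"
  shows "continuous_on {0..a} (\<lambda>y. weight y * \<gamma> y * osc w y * F y)"
  using C_on_powers(1,2)[of 0] C_on_osc[of 0] assms by (auto intro!: continuous_on_mult)

lemma solution_linear:
  assumes F: "continuous_on {0..a} F" and G: "continuous_on {0..a} G" and x: "x \<in> {0..a}"
  shows "solution w (\<lambda>y. c * (F y + G y)) x = c * (solution w F x + solution w G x)"
proof -
  let ?k = "\<lambda>F v. complex_of_real ((v powr p) ^ 0) *
      (\<lambda>y. weight y * \<gamma> y * osc w y * F y) (v powr p * x)"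
  have "((\<lambda>v. c * (?k F v + ?k G v)) has_integral c *
      (dilation_mean p 0 (\<lambda>y. weight y * \<gamma> y * osc w y * F y) x +
       dilation_mean p 0 (\<lambda>y. weight y * \<gamma> y * osc w y * G y) x)) {0..1}"
    unfolding dilation_mean_def
    by (intro has_integral_add has_integral_mult_right integrable_integral
          integrable_continuous_real continuous_on_dilation_slice continuous_on_solution_integrand F G x p_pos)
  then have "dilation_mean p 0 (\<lambda>y. weight y * \<gamma> y * osc w y * (c * (F y + G y))) x = c *
      (dilation_mean p 0 (\<lambda>y. weight y * \<gamma> y * osc w y * F y) x +
       dilation_mean p 0 (\<lambda>y. weight y * \<gamma> y * osc w y * G y) x)"
    by (simp add: dilation_mean_def integral_unique algebra_simps)
  then show ?thesis
    by (simp add: solution_def algebra_simps)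
qed

lemma solution_cong:
  assumes "\<And>y. y \<in> {0..a} \<Longrightarrow> F y = G y" and "x \<in> {0..a}"
  shows "solution w F x = solution w G x"
proof -
  have "dilation_mean p 0 (\<lambda>y. weight y * \<gamma> y * osc w y * F y) x =
      dilation_mean p 0 (\<lambda>y. weight y * \<gamma> y * osc w y * G y) x"
    unfolding dilation_mean_def using dilate_in_Icc[OF p_pos _ assms(2)] assms(1)
    by (intro integral_cong) simp
  then show ?thesis by (simp add: solution_def)
qed

lemma p_times: "complex_of_real p * (1 + of_real \<alpha>) = 1"
proof -
  have "p * (1 + \<alpha>) = 1" using \<alpha> by (simp add: p_def)
  then show ?thesis by (metis of_real_1 of_real_add of_real_mult)
qed

text \<open>
  The dilation mean solves an Euler equation. Since the two outer factors \<open>h powr (-1-\<alpha>)\<close> and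
  \<open>e^(-\<i> w g)\<close> satisfy first order equations of their own, the product rule adds exactly the missing
  terms.
\<close>

lemma solution_ode:
  assumes F: "C_on (Suc 0) {0..a} F" and x: "x \<in> {0..a}"
  shows "of_real (g x) * D (solution w F) x + (1 + of_real \<alpha> + \<i> * of_real w * of_real (g x)) * \<gamma> x * solution w F x
    = \<gamma> x * F x"
proof -
  define \<psi> where "\<psi> = (\<lambda>y. weight y * \<gamma> y * osc w y * F y)"
  define N where "N = dilation_mean p 0 \<psi> x"
  define N' where "N' = dilation_mean p 1 (D \<psi>) x"
  define h h' where "h = complex_of_real (slope x)" and "h' = D (\<lambda>x. complex_of_real (slope x)) x"
  define \<kappa> e where "\<kappa> = coweight x" and "e = osc (- w) x"
  have \<psi>: "C_on (Suc 0) {0..a} \<psi>"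
    unfolding \<psi>_def by (intro C_on_mult C_on_powers C_on_osc F) auto
  have "(dilation_mean p 0 \<psi> has_vector_derivative N') (at x within {0..a})"
    using has_vector_derivative_dilation_mean[OF p_pos C_on_Suc_deriv[OF \<psi>] _ x, of 0] \<psi>
    by (simp add: N'_def C_on_Suc)
  then have "((\<lambda>x. of_real p * (coweight x * (osc (- w) x * dilation_mean p 0 \<psi> x)))
      has_vector_derivative of_real p * (coweight x * (osc (- w) x * N' +
        (\<i> * of_real (- w) * \<gamma> x * osc (- w) x) * dilation_mean p 0 \<psi> x) +
        (- (1 + of_real \<alpha>) * coweight x * D (\<lambda>x. complex_of_real (slope x)) x / of_real (slope x)) *
        (osc (- w) x * dilation_mean p 0 \<psi> x)))
      (at x within {0..a})"
    by (intro has_vector_derivative_mult_right has_vector_derivative_mult osc_deriv[OF x]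
          coweight_deriv[OF x])
  moreover have "solution w F = (\<lambda>x. of_real p * (coweight x * (osc (- w) x * dilation_mean p 0 \<psi> x)))"
    by (simp add: fun_eq_iff solution_def \<psi>_def mult.assoc)
  ultimately have "(solution w F has_vector_derivative of_real p * (\<kappa> * (e * N' +
        (\<i> * of_real (- w) * \<gamma> x * e) * N) + (- (1 + of_real \<alpha>) * \<kappa> * h' / h) * (e * N)))
      (at x within {0..a})"
    by (simp only: N_def h_def h'_def \<kappa>_def e_def)
  then have DJ: "D (solution w F) x = of_real p * (\<kappa> * (e * N' +
        (\<i> * of_real (- w) * \<gamma> x * e) * N) + (- (1 + of_real \<alpha>) * \<kappa> * h' / h) * (e * N))"
    by (rule D_eqI[OF _ x])
  have solution: "solution w F x = of_real p * \<kappa> * e * N"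
    by (simp add: solution_def \<psi>_def N_def \<kappa>_def e_def)
  have g: "complex_of_real (g x) = of_real x * h"
    by (simp add: g_eq h_def)
  have h0: "h \<noteq> 0" using slope_pos[OF x] by (simp add: h_def)
  have h': "of_real x * h' = \<gamma> x - h"
    using slope_ode[OF x] by (simp add: h_def h'_def algebra_simps)
  have N: "of_real p * of_real x * N' = \<psi> x - N"
    using dilation_mean_ode[OF p_pos \<psi> x] by (simp add: N_def N'_def algebra_simps)
  have "of_real (g x) * D (solution w F) x = h * \<kappa> * e * (of_real p * of_real x * N')
      - \<i> * of_real w * of_real (g x) * \<gamma> x * solution w F x
      - (of_real p * (1 + of_real \<alpha>)) * \<kappa> * (of_real x * h') * (e * N)"
    unfolding DJ solution g using h0 by (simp add: field_simps)
  also have "\<dots> = h * \<kappa> * e * \<psi> x - \<i> * of_real w * of_real (g x) * \<gamma> x * solution w F x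
      - \<kappa> * \<gamma> x * (e * N)"
    unfolding h' N p_times by (simp add: algebra_simps)
  also have "h * \<kappa> * e * \<psi> x = (\<kappa> * h * weight x) * (e * osc w x) * \<gamma> x * F x"
    by (simp add: \<psi>_def mult_ac)
  also have "\<dots> = \<gamma> x * F x"
    using coweight_weight[OF x] osc_uminus[of w x] by (simp add: \<kappa>_def h_def e_def)
  also have "\<kappa> * \<gamma> x * (e * N) = (1 + of_real \<alpha>) * \<gamma> x * solution w F x"
  proof -
    have "(1 + of_real \<alpha>) * \<gamma> x * solution w F x = (of_real p * (1 + of_real \<alpha>)) * (\<kappa> * \<gamma> x * (e * N))"
      unfolding solution by (simp only: mult_ac)
    then show ?thesis by (simp only: p_times mult_1)
  qed
  finally show ?thesis by (simp add: algebra_simps)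
qed

lemma amplitude_times_g:
  assumes F: "C_on (Suc 0) {0..a} F" and x: "x \<in> {0..a}"
  shows "F x - F 0 = \<i> * of_real (g x) * amplitude F x"
proof -
  have "of_real (slope x) * of_real (slope x powr (- 1)) = (1 :: complex)"
    using slope_pos[OF x] by (simp add: powr_minus)
  moreover have "\<i> * of_real (g x) * amplitude F x = (of_real (slope x) * of_real (slope x powr (- 1))) *
      (of_real x * dilation_mean 1 0 (D F) x)"
    by (simp add: amplitude_def g_eq mult_ac)
  ultimately show ?thesis
    using dilation_mean_deriv_eq_diff[OF F x] by simp
qed

lemma C_on_amplitude:
  assumes "C_on (Suc k) {0..a} F" and "k \<le> Suc m"
  shows "C_on k {0..a} (amplitude F)"
  unfolding amplitude_def[abs_def] using assms
  by (intro C_on_mult C_on_const C_on_powers C_on_dilation_mean) (auto simp: C_on_Suc)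

lemma C_on_residual:
  assumes "C_on (Suc k) {0..a} F" and "k \<le> Suc m"
  shows "C_on k {0..a} (residual F)"
  unfolding residual_def[abs_def] using assms
  by (intro C_on_add C_on_mult C_on_const C_on_powers C_on_amplitude) (auto simp: C_on_Suc)

text \<open>
  Substituting the amplitude into the differential operator gives the right-hand side
  \<open>w (F - F(0)) - residual F\<close>. As the amplitude of a function in \<open>C\<^sup>1\<close> need not be differentiable at \<open>0\<close>,
  uniqueness of the solution is not invoked through the equation itself but through
  \<open>dilation_mean_eqI\<close>, applied to \<open>Y = h powr (1+\<alpha>) e^(\<i> w g) A\<close>.
\<close>

lemma solution_by_parts:
  assumes F: "C_on (Suc 0) {0..a} F" and x: "x \<in> {0..a}"
  shows "solution w (\<lambda>y. of_real w * (F y - F 0) - residual F y) x = amplitude F x"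
proof -
  let ?h = "\<lambda>y. complex_of_real (slope y)"
  \<comment> \<open>The product \<open>Z = x Y\<close> is \<open>C\<^sup>1\<close> on the whole interval, whereas \<open>Y = Z / x\<close> is differentiated only away from \<open>0\<close>.\<close>
  define Y where "Y = (\<lambda>y. - \<i> * (weight y * (osc w y * dilation_mean 1 0 (D F) y)))"
  define Z where "Z = (\<lambda>y. - \<i> * (weight y * (osc w y * (F y - F 0))))"
  define Z' where "Z' = (\<lambda>y. - \<i> * (weight y * (osc w y * D F y +
      (\<i> * of_real w * \<gamma> y * osc w y) * (F y - F 0)) +
      (of_real \<alpha> * weight y * D ?h y / ?h y) * (osc w y * (F y - F 0))))"
  have Y_Z: "of_real y * Y y = Z y" if "y \<in> {0..a}" for y
    using dilation_mean_deriv_eq_diff[OF F that] by (simp add: Y_def Z_def mult_ac)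
  have Y_amp: "Y y = weight y * osc w y * ?h y * amplitude F y" if "y \<in> {0..a}" for y
    using slope_pos[OF that] by (simp add: Y_def amplitude_def powr_minus)
  have Z_deriv: "(Z has_vector_derivative Z' y) (at y within {0..a})" if "y \<in> {0..a}" for y
  proof -
    have "((\<lambda>y. F y - F 0) has_vector_derivative D F y) (at y within {0..a})"
      using has_vector_derivative_diff[OF C_on_Suc_deriv[OF F that] has_vector_derivative_const] by simp
    then show ?thesis unfolding Z_def Z'_def
      by (intro has_vector_derivative_mult_right has_vector_derivative_mult osc_deriv[OF that]
          weight_deriv[OF that])
  qed
  have "dilation_mean p 0
      (\<lambda>y. weight y * \<gamma> y * osc w y * (of_real p * (of_real w * (F y - F 0) - residual F y))) x = Y x"
  proof (rule dilation_mean_eqI[OF p_pos _ _ _ x])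
    have "continuous_on {0..a} (D F)" using F by (simp add: C_on_Suc)
    then show "continuous_on {0..a} Y"
      unfolding Y_def using C_on_powers(2)[of 0] C_on_osc[of 0]
      by (intro continuous_on_mult continuous_on_const continuous_on_dilation_mean) auto
  next
    fix y assume y: "y \<in> {0<..a}"
    have "((\<lambda>y. of_real (inverse y) * Z y) has_vector_derivative
        of_real (inverse y) * Z' y + of_real (- (inverse y ^ Suc (Suc 0))) * Z y) (at y within {0..a})"
      using y by (intro has_vector_derivative_mult Z_deriv has_vector_derivative_of_real DERIV_inverse) auto
    moreover have "of_real (inverse y) * Z' y + of_real (- (inverse y ^ Suc (Suc 0))) * Z y
        = (Z' y - Y y) / of_real y"
    proof -
      have "Z y = of_real y * Y y" using Y_Z[of y] y by simp
      then show ?thesis using y by (simp add: divide_simps)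
    qed
    ultimately have "((\<lambda>y. of_real (inverse y) * Z y) has_vector_derivative
        (Z' y - Y y) / of_real y) (at y within {0..a})"
      by (simp only:)
    then show "(Y has_vector_derivative (Z' y - Y y) / of_real y) (at y within {0..a})"
    proof (rule has_vector_derivative_transform_within)
      show "0 < y" using y by simp
      show "of_real (inverse z) * Z z = Y z" if "z \<in> {0..a}" "dist z y < y" for z
      proof -
        have "z \<noteq> 0" using that by (auto simp: dist_real_def)
        then show ?thesis
          unfolding Y_Z[OF that(1), symmetric] of_real_inverse mult.assoc[symmetric] by simp
      qed
    qed (use y in auto)
  next
    fix y assume y: "y \<in> {0..a}"
    have h0: "?h y \<noteq> 0" using slope_pos[OF y] by simp
    have \<gamma>0: "\<gamma> y * of_real (D g y powr (- 1)) = 1"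
      using g'_pos[OF y] by (simp add: \<gamma>_def powr_minus)
    have F_amp: "F y - F 0 = \<i> * (of_real y * ?h y) * amplitude F y"
      using amplitude_times_g[OF F y] by (simp add: g_eq)
    have h': "of_real y * D ?h y = \<gamma> y - ?h y"
      using slope_ode[OF y] by (simp add: algebra_simps)
    have \<gamma>_residual: "\<gamma> y * residual F y = \<i> * D F y - of_real \<alpha> * \<gamma> y * amplitude F y"
    proof -
      have "\<gamma> y * residual F y = \<i> * D F y * (\<gamma> y * of_real (D g y powr (- 1))) - of_real \<alpha> * \<gamma> y * amplitude F y"
        by (simp add: residual_def algebra_simps)
      then show ?thesis using \<gamma>0 by simp
    qed
    have "of_real \<alpha> * weight y * D ?h y / ?h y * (osc w y * (F y - F 0)) =
        \<i> * of_real \<alpha> * weight y * osc w y * (of_real y * D ?h y) * amplitude F y"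
      unfolding F_amp using h0 by simp
    also have "\<dots> = \<i> * of_real \<alpha> * weight y * osc w y * (\<gamma> y - ?h y) * amplitude F y"
      unfolding h' ..
    finally have Z': "Z' y = - \<i> * (weight y * (osc w y * D F y +
        (\<i> * of_real w * \<gamma> y * osc w y) * (F y - F 0)) +
        \<i> * of_real \<alpha> * weight y * osc w y * (\<gamma> y - ?h y) * amplitude F y)"
      unfolding Z'_def by simp
    have ii: "\<i> * (\<i> * c) = - c" for c
      by (simp add: mult.assoc[symmetric])
    have Z'_eq: "Z' y + of_real \<alpha> * Y y =
        weight y * osc w y * (of_real w * \<gamma> y * (F y - F 0) - \<gamma> y * residual F y)"
      unfolding Z' Y_amp[OF y] \<gamma>_residual by (simp add: algebra_simps ii)
    have "of_real (p * y) * ((Z' y - Y y) / of_real y) = of_real p * (Z' y - Y y)"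
        \<comment> \<open>At \<open>y = 0\<close> the quotient is \<open>0\<close> by the convention for division, so \<open>Z' 0 = Y 0\<close> is needed there.\<close>
    proof (cases "y = 0")
      case True
      have "Z' y = Y y"
        unfolding Z'_def Y_def True by (simp add: dilation_mean_def)
      then show ?thesis by simp
    qed simp
    then have "of_real (p * y) * ((Z' y - Y y) / of_real y) + Y y =
        of_real p * (Z' y - Y y) + of_real p * (1 + of_real \<alpha>) * Y y"
      by (simp only: p_times mult_1)
    also have "\<dots> = of_real p * (Z' y + of_real \<alpha> * Y y)"
      by (simp add: algebra_simps)
    also have "\<dots> = weight y * \<gamma> y * osc w y * (of_real p * (of_real w * (F y - F 0) - residual F y))"
      unfolding Z'_eq by (simp add: algebra_simps)
    finally show "of_real (p * y) * ((Z' y - Y y) / of_real y) + Y y =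
        weight y * \<gamma> y * osc w y * (of_real p * (of_real w * (F y - F 0) - residual F y))" .
  qed
  moreover have "(\<lambda>y. weight y * \<gamma> y * osc w y * (of_real p * (of_real w * (F y - F 0) - residual F y))) =
      (\<lambda>y. of_real p * (weight y * \<gamma> y * osc w y * (of_real w * (F y - F 0) - residual F y)))"
    by (simp add: mult_ac)
  ultimately have "of_real p * dilation_mean p 0
      (\<lambda>y. weight y * \<gamma> y * osc w y * (of_real w * (F y - F 0) - residual F y)) x = Y x"
    by (simp only: dilation_mean_cmult)
  then have "solution w (\<lambda>y. of_real w * (F y - F 0) - residual F y) x = coweight x * osc (- w) x * Y x"
    by (simp add: solution_def mult_ac)
  also have "\<dots> = (coweight x * ?h x * weight x) * (osc (- w) x * osc w x) * amplitude F x"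
    unfolding Y_amp[OF x] by (simp only: mult_ac)
  finally show ?thesis
    by (simp add: coweight_weight[OF x] osc_uminus)
qed

section \<open>Expansion in inverse powers of the frequency\<close>

text \<open>
  Each step of the induction applies \<open>solution_by_parts\<close> once: if \<open>c'\<close> is the constant that serves
  \<open>residual F\<close>, then \<open>F(0) + c' / w\<close> serves \<open>F\<close>, since the solution depends linearly on the
  right-hand side. In the size, \<open>1 / w\<close> stands for the amplitudes and \<open>w ^ n / w ^ k\<close> for the
  oscillatory remainder, whose \<open>n\<close> derivatives cost \<open>w ^ n\<close>.
\<close>

lemma nonoscillatory_expansion:
  assumes "C_on (n + k) {0..a} F" and "n + k \<le> Suc m"
  shows "\<exists>c K. (\<forall>w\<ge>1. norm (c w) \<le> K) \<and>
    scaled_C {1..} (\<lambda>w. 1) n (\<lambda>w. 1 / w + w ^ n / w ^ k) (\<lambda>w. solution w (\<lambda>x. F x - c w))"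
  using assms
proof (induction k arbitrary: F)
  case 0
  have "scaled_C {1..} (\<lambda>w. 1) n (\<lambda>w. 1 / w + w ^ n / w ^ 0) (\<lambda>w. solution w F)"
  proof (rule scaled_C_weaken[OF scaled_C_solution, of n F _ n "2 ^ n"])
    fix w :: real and i assume w: "w \<in> {1..}" and i: "i \<le> n"
    have "(1 + w) ^ i \<le> (2 * w) ^ i"
      using w by (intro power_mono) auto
    also have "\<dots> \<le> (2 * w) ^ n"
      using w i by (intro power_increasing) auto
    also have "\<dots> \<le> 2 ^ n * (1 / w + w ^ n)"
      using w by (simp add: power_mult_distrib)
    finally show "1 * (1 + w) ^ i \<le> 2 ^ n * ((1 / w + w ^ n / w ^ 0) * 1 ^ i)"
      by simp
  qed (use 0 in auto)
  then show ?case
    by (intro exI[of _ "\<lambda>w. 0"] exI[of _ 0]) simp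
next
  case (Suc k)
  have F1: "C_on (Suc 0) {0..a} F" "C_on (Suc (n + k)) {0..a} F" "C_on (Suc n) {0..a} F"
    using C_on_le[OF Suc.prems(1)] by auto
  have residual_C: "C_on (n + k) {0..a} (residual F)"
    using F1(2) Suc.prems(2) by (intro C_on_residual) auto
  then obtain c K where cK: "\<And>w. 1 \<le> w \<Longrightarrow> norm (c w) \<le> K"
    and IH: "scaled_C {1..} (\<lambda>w. 1) n (\<lambda>w. 1 / w + w ^ n / w ^ k) (\<lambda>w. solution w (\<lambda>x. residual F x - c w))"
    using Suc.IH[OF residual_C] Suc.prems(2) by auto
  define \<rho> where "\<rho> w = 1 + (1 / w + w ^ n / w ^ k)" for w :: real
  have "scaled_C {1..} (\<lambda>w. 1) n \<rho> (\<lambda>w. solution w (\<lambda>x. residual F x - c w))"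
    by (rule scaled_C_weaken[OF IH, of _ _ 1]) (auto simp: \<rho>_def)
  moreover have "scaled_C {1..} (\<lambda>w. 1) n \<rho> (\<lambda>w. amplitude F)"
    using F1(3) Suc.prems(2) by (intro scaled_C_of_C_on C_on_amplitude) (auto simp: \<rho>_def)
  moreover have "scaled_C {1..} (\<lambda>w. 1) n (\<lambda>w. 1 / w) (\<lambda>w x. complex_of_real (1 / w))"
    by (rule scaled_C_const[of 1]) (auto simp: norm_divide)
  ultimately have "scaled_C {1..} (\<lambda>w. 1) n (\<lambda>w. 1 / w * \<rho> w)
      (\<lambda>w x. complex_of_real (1 / w) * (amplitude F x + solution w (\<lambda>x. residual F x - c w) x))"
    by (intro scaled_C_mult scaled_C_add)
  then have "scaled_C {1..} (\<lambda>w. 1) n (\<lambda>w. 1 / w + w ^ n / w ^ Suc k)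
      (\<lambda>w x. complex_of_real (1 / w) * (amplitude F x + solution w (\<lambda>x. residual F x - c w) x))"
  proof (rule scaled_C_weaken[of _ _ _ _ _ _ _ 2])
    fix w :: real and i assume w: "w \<in> {1..}"
    have "1 / w * (1 / w) \<le> 1 / w * 1"
      using w by (intro mult_left_mono) auto
    moreover have "1 / w * (w ^ n / w ^ k) = w ^ n / w ^ Suc k" "0 \<le> w ^ n / w ^ Suc k"
      using w by auto
    ultimately show "1 / w * \<rho> w * 1 ^ i \<le> 2 * ((1 / w + w ^ n / w ^ Suc k) * 1 ^ i)"
      by (simp only: \<rho>_def distrib_left power_one mult_1_right)
  qed auto
  moreover have "complex_of_real (1 / w) * (amplitude F x + solution w (\<lambda>x. residual F x - c w) x) =
      solution w (\<lambda>x. F x - (F 0 + c w / of_real w)) x" if w: "w \<in> {1..}" and x: "x \<in> {0..a}" for w x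
  proof -
    have cont: "continuous_on {0..a} F" "continuous_on {0..a} (residual F)"
      using C_on_imp_continuous_on F1(1) residual_C by auto
    have "complex_of_real (1 / w) * (amplitude F x + solution w (\<lambda>x. residual F x - c w) x) = complex_of_real (1 / w) *
        (solution w (\<lambda>y. of_real w * (F y - F 0) - residual F y) x + solution w (\<lambda>x. residual F x - c w) x)"
      using solution_by_parts[OF F1(1) x] by simp
    also have "\<dots> = solution w (\<lambda>y. of_real (1 / w) *
        ((of_real w * (F y - F 0) - residual F y) + (residual F y - c w))) x"
      using cont x by (intro solution_linear[symmetric] continuous_intros)
    also have "\<dots> = solution w (\<lambda>x. F x - (F 0 + c w / of_real w)) x"
      using w x by (intro solution_cong) (auto simp: field_simps)
    finally show ?thesis .
  qed
  ultimately have "scaled_C {1..} (\<lambda>w. 1) n (\<lambda>w. 1 / w + w ^ n / w ^ Suc k)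
      (\<lambda>w. solution w (\<lambda>x. F x - (F 0 + c w / of_real w)))"
    by (rule scaled_C_cong[rotated])
  moreover have "norm (F 0 + c w / of_real w) \<le> norm (F 0) + K" if "1 \<le> w" for w
  proof -
    have "norm (c w / of_real w) \<le> norm (c w)"
      using that by (simp add: norm_divide divide_le_eq mult_le_cancel_left1)
    then show ?thesis
      using norm_triangle_ineq[of "F 0" "c w / of_real w"] cK[OF that] by linarith
  qed
  ultimately show ?case
    by (intro exI[of _ "\<lambda>w. F 0 + c w / of_real w"] exI[of _ "norm (F 0) + K"]) simp
qed

text \<open>
  With \<open>k = n + 1\<close> both contributions to the size are \<open>1 / w\<close>. For \<open>w < 1\<close> the derivatives of the
  oscillating factors are bounded, so \<open>c = 0\<close> already gives a bound \<open>K \<le> K / w\<close>.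
\<close>

lemma uniform_bounds:
  assumes F: "C_on (n + Suc n) {0..a} F" and nm: "n + Suc n \<le> Suc m"
  shows "\<exists>K\<ge>0. \<forall>w>0. \<exists>c. norm c \<le> K \<and> C_on n {0..a} (solution w (\<lambda>x. F x - c)) \<and>
    (\<forall>j\<le>n. \<forall>x\<in>{0..a}. norm (iter_deriv_on {0..a} j (solution w (\<lambda>x. F x - c)) x) \<le> K / w)"
proof -
  obtain c Kc where c: "\<And>w. 1 \<le> w \<Longrightarrow> norm (c w) \<le> Kc"
    and large: "scaled_C {1..} (\<lambda>w. 1) n (\<lambda>w. 1 / w + w ^ n / w ^ Suc n) (\<lambda>w. solution w (\<lambda>x. F x - c w))"
    using nonoscillatory_expansion[OF F nm] by auto
  have small: "scaled_C {0<..} (\<lambda>w. 1 + w) n (\<lambda>w. 1) (\<lambda>w. solution w F)"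
    using C_on_le[OF F] nm by (intro scaled_C_solution) auto
  obtain K1 where K1: "0 \<le> K1" "\<And>w j x. w \<in> {1..} \<Longrightarrow> j \<le> n \<Longrightarrow> x \<in> {0..a} \<Longrightarrow>
      norm (iter_deriv_on {0..a} j (solution w (\<lambda>x. F x - c w)) x) \<le> K1 * ((1 / w + w ^ n / w ^ Suc n) * 1 ^ j)"
    by (rule scaled_C_E[OF large]) blast
  obtain K2 where K2: "0 \<le> K2" "\<And>w j x. w \<in> {0<..} \<Longrightarrow> j \<le> n \<Longrightarrow> x \<in> {0..a} \<Longrightarrow>
      norm (iter_deriv_on {0..a} j (solution w F) x) \<le> K2 * (1 * (1 + w) ^ j)"
    by (rule scaled_C_E[OF small]) blast
  define K where "K = \<bar>Kc\<bar> + 2 * K1 + 2 ^ n * K2"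
  have "0 \<le> 2 ^ n * K2"
    using K2(1) by simp
  then have K: "0 \<le> K" "Kc \<le> K" "K1 * 2 \<le> K" "K2 * 2 ^ n \<le> K"
    using K1(1) unfolding K_def mult.commute[of K2] by linarith+
  have "\<exists>c. norm c \<le> K \<and> C_on n {0..a} (solution w (\<lambda>x. F x - c)) \<and>
      (\<forall>j\<le>n. \<forall>x\<in>{0..a}. norm (iter_deriv_on {0..a} j (solution w (\<lambda>x. F x - c)) x) \<le> K / w)"
    if w: "0 < w" for w
  proof (cases "1 \<le> w")
    case True
    have "norm (iter_deriv_on {0..a} j (solution w (\<lambda>x. F x - c w)) x) \<le> K / w"
      if "j \<le> n" "x \<in> {0..a}" for j x
    proof -
      have "K1 * ((1 / w + w ^ n / w ^ Suc n) * 1 ^ j) = K1 * 2 / w"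
        using w by (simp add: field_simps)
      also have "\<dots> \<le> K / w"
        using K(3) w by (intro divide_right_mono) auto
      finally show ?thesis
        using K1(2)[of w j x] that True by simp
    qed
    then show ?thesis
      using c[OF True] K(2) scaled_C_D(3)[OF large, of w] True by (intro exI[of _ "c w"]) auto
  next
    case False
    have "norm (iter_deriv_on {0..a} j (solution w F) x) \<le> K / w" if "j \<le> n" "x \<in> {0..a}" for j x
    proof -
      have "(1 + w) ^ j \<le> 2 ^ j"
        using w False by (intro power_mono) auto
      also have "\<dots> \<le> 2 ^ n"
        using that(1) by (intro power_increasing) auto
      finally have "K2 * (1 * (1 + w) ^ j) \<le> K2 * 2 ^ n"
        using K2(1) by (intro mult_left_mono) auto
      also have "\<dots> \<le> K / 1"
        using K(4) by simp
      also have "\<dots> \<le> K / w"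
        using K(1) w False by (intro divide_left_mono) auto
      finally show ?thesis
        using K2(2)[of w j x] that w by simp
    qed
    then show ?thesis
      using K(1) scaled_C_D(3)[OF small, of w] w by (intro exI[of _ 0]) auto
  qed
  then show ?thesis using K(1) by blast
qed

end

theorem lemma2p1:
  fixes a \<alpha> :: real and n :: nat
    and f\<^sub>1 :: "real \<Rightarrow> complex" and g :: "real \<Rightarrow> real"
  assumes "a > 0"
    and "0 < \<bar>\<alpha>\<bar>" and "\<bar>\<alpha>\<bar> < 1"
    and "C_on (2 * n + 1) {0..a} f\<^sub>1"
    and "C_on (2 * n + 2) {0..a} g"
    and "g 0 = 0"
    and "\<forall>x\<in>{0..a}. iter_deriv_on {0..a} 1 g x > 0"
  shows "\<exists>C::real. \<forall>w::real. w > 0 \<longrightarrow>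
    (\<exists>(q\<^sub>1 :: real \<Rightarrow> complex) (c\<^sub>0 :: complex).
      q\<^sub>1 differentiable_on {0..a} \<and> C_on n {0..a} q\<^sub>1 \<and>
      (\<forall>x\<in>{0..a}.
        \<i> * of_real w * of_real (iter_deriv_on {0..a} 1 g x) * c\<^sub>0
        + of_real (g x) * iter_deriv_on {0..a} 1 q\<^sub>1 x
        + (1 + of_real \<alpha> + \<i> * of_real w * of_real (g x))
            * of_real (iter_deriv_on {0..a} 1 g x) * q\<^sub>1 x
        = f\<^sub>1 x) \<and>
      norm c\<^sub>0 < C / w \<and>
      (\<forall>j\<le>n. sup_norm_on {0..a} (iter_deriv_on {0..a} j q\<^sub>1) < C / w))"
proof -
  interpret monotone_phase a \<alpha> g "2 * n"
    using assms by unfold_locales (auto simp: iter_deriv_on_1[symmetric])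
  define F where "F x = of_real (deriv_on {0..a} g x powr (- 1)) * f\<^sub>1 x" for x
  have F: "C_on (n + Suc n) {0..a} F"
    unfolding F_def[abs_def] using assms(4) by (intro C_on_mult C_on_powers) (simp_all add: mult_2)
  have \<gamma>F: "\<gamma> x * F x = f\<^sub>1 x" if "x \<in> {0..a}" for x
    using g'_pos[OF that] by (simp add: F_def \<gamma>_def powr_minus)
  obtain K where K: "0 \<le> K" and ex: "\<And>w. 0 < w \<Longrightarrow> \<exists>c. norm c \<le> K \<and>
      C_on n {0..a} (solution w (\<lambda>x. F x - c)) \<and>
      (\<forall>j\<le>n. \<forall>x\<in>{0..a}. norm (iter_deriv_on {0..a} j (solution w (\<lambda>x. F x - c)) x) \<le> K / w)"
    using uniform_bounds[OF F] by auto
  show ?thesis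
  \<comment> \<open>The summand \<open>1\<close> makes the inequalities strict.\<close>
  proof (intro exI[of _ "K + 1"] allI impI)
    fix w :: real assume w: "w > 0"
    obtain c where c: "norm c \<le> K" and C_q: "C_on n {0..a} (solution w (\<lambda>x. F x - c))"
      and bound: "\<And>j x. j \<le> n \<Longrightarrow> x \<in> {0..a} \<Longrightarrow>
        norm (iter_deriv_on {0..a} j (solution w (\<lambda>x. F x - c)) x) \<le> K / w"
      using ex[OF w] by blast
    define q c0 where "q = solution w (\<lambda>x. F x - c)" and "c0 = c / (\<i> * of_real w)"
    have less: "K / w < (K + 1) / w"
      using w by (intro divide_strict_right_mono) auto
    have G: "C_on (Suc 0) {0..a} (\<lambda>x. F x - c)"
      using C_on_add[OF C_on_le[OF F] C_on_const[of _ "- c"], of "Suc 0"] by simp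
    have "C_on (Suc 0) {0..a} q"
      unfolding q_def using scaled_C_D(3)[OF scaled_C_solution[OF G], of w] w by simp
    then have diff: "q differentiable_on {0..a}"
      by (simp add: C_on_Suc)
    have ode: "\<i> * of_real w * of_real (iter_deriv_on {0..a} 1 g x) * c0
        + of_real (g x) * iter_deriv_on {0..a} 1 q x
        + (1 + of_real \<alpha> + \<i> * of_real w * of_real (g x))
            * of_real (iter_deriv_on {0..a} 1 g x) * q x = f\<^sub>1 x" if x: "x \<in> {0..a}" for x
    proof -
      have "\<i> * of_real w * c0 = c"
        using w by (simp add: c0_def)
      then have c0: "\<i> * of_real w * \<gamma> x * c0 = \<gamma> x * c"
        by (metis mult.assoc mult.commute)
      have "of_real (g x) * D q x + (1 + of_real \<alpha> + \<i> * of_real w * of_real (g x)) * \<gamma> x * q x =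
          f\<^sub>1 x - \<gamma> x * c"
        using solution_ode[OF G x, of w] \<gamma>F[OF x] by (simp add: q_def right_diff_distrib)
      then show ?thesis
        unfolding iter_deriv_on_1 \<gamma>_def[symmetric] c0 add.assoc by simp
    qed
    have "norm c0 = norm c / w"
      using w by (simp add: c0_def norm_divide norm_mult)
    also have "\<dots> \<le> K / w"
      using c w by (intro divide_right_mono) auto
    finally have c0: "norm c0 < (K + 1) / w"
      using less by linarith
    have sup: "sup_norm_on {0..a} (iter_deriv_on {0..a} j q) < (K + 1) / w" if "j \<le> n" for j
    proof -
      have "sup_norm_on {0..a} (iter_deriv_on {0..a} j q) \<le> K / w"
        unfolding sup_norm_on_def q_def using bound[OF that] assms(1) by (intro cSUP_least) auto
      then show ?thesis using less by linarith
    qed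
    show "\<exists>q\<^sub>1 c\<^sub>0. q\<^sub>1 differentiable_on {0..a} \<and> C_on n {0..a} q\<^sub>1 \<and>
      (\<forall>x\<in>{0..a}.
        \<i> * of_real w * of_real (iter_deriv_on {0..a} 1 g x) * c\<^sub>0
        + of_real (g x) * iter_deriv_on {0..a} 1 q\<^sub>1 x
        + (1 + of_real \<alpha> + \<i> * of_real w * of_real (g x))
            * of_real (iter_deriv_on {0..a} 1 g x) * q\<^sub>1 x
        = f\<^sub>1 x) \<and>
      norm c\<^sub>0 < (K + 1) / w \<and>
      (\<forall>j\<le>n. sup_norm_on {0..a} (iter_deriv_on {0..a} j q\<^sub>1) < (K + 1) / w)"
      using diff C_q ode c0 sup by (intro exI[of _ q] exI[of _ c0]) (simp add: q_def)
  qed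
qed

end
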